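(* Let $f(v_1,\dots,v_n)$ be a boolean function and $F$ a clause-set such that: $\{v_1,\dots,v_n\}\subseteq\mathrm{var}(F)$; for every partial assignment $\varphi$ with $\mathrm{var}(\varphi)\subseteq\{v_1,\dots,v_n\}$ such that no total assignment $\psi\supseteq\varphi$ to $v_1,\dots,v_n$ has $f(\psi)=1$, we have $r_1(\varphi*F)=\{\bot\}$; and for all other such $\varphi$, $\varphi*F$ is satisfiable. Then from $F$ one can compute in time $O(\ell(F)\cdot n(F)^2)$ a monotone circuit (using only and- and or-gates) computing $\widehat{f}(v_1',v_1'',\dots,v_n',v_n'')$.
   Context: Literals, clauses (finite sets of literals without complementary pairs), clause-sets (finite sets of clauses), $\bot$ the empty clause; $\mathrm{var}(F)$, $n(F)=|\mathrm{var}(F)|$, $\ell(F)=\sum_{C\in F}|C|$. A partial assignment $\varphi$ maps a finite set of variables to $\{0,1\}$; $\varphi*F$ deletes clauses containing a literal set to $1$ and deletes literals set to $0$. $r_1$ is unit-clause propagation: $r_1(F)=\{\bot\}$ if $\bot\in F$, $r_1(F)=F$ if all clauses have length $\ge2$, otherwise $r_1(F)=r_1(\langle x\to1\rangle*F)$ for some unit clause $\{x\}\in F$. The monotonisation $\widehat{f}$ of $f(v_1,\dots,v_n)$ is the boolean function of $2n$ variables with $\widehat{f}(v_1',v_1'',\dots,v_n',v_n'')=1$ iff there is a total assignment $\psi$ to $v_1,\dots,v_n$ with $f(\psi)=1$ such that for all $i$: $\psi(v_i)=0$ implies $v_i'=1$, and $\psi(v_i)=1$ implies $v_i''=1$. (Intuitively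 $v_i'=v_i''=1$ means $v_i$ unassigned, $v_i'=1,v_i''=0$ means $v_i=0$, $v_i'=0,v_i''=1$ means $v_i=1$, and $v_i'=v_i''=0$ is a contradiction.) *)

theory Defs
  imports Main
begin

section \<open>Clause-sets and unit-clause propagation\<close>

datatype 'v literal = Pos 'v | Neg 'v

fun lit_var :: "'v literal \<Rightarrow> 'v" where
  "lit_var (Pos v) = v"
| "lit_var (Neg v) = v"

fun compl :: "'v literal \<Rightarrow> 'v literal" where
  "compl (Pos v) = Neg v"
| "compl (Neg v) = Pos v"

type_synonym 'v clause = "'v literal set"
type_synonym 'v clauses = "'v clause set"

definition is_clause :: "'v clause \<Rightarrow> bool" where
  "is_clause C \<longleftrightarrow> finite C \<and> (\<forall>x\<in>C. compl x \<notin> C)"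

definition is_clause_set :: "'v clauses \<Rightarrow> bool" where
  "is_clause_set F \<longleftrightarrow> finite F \<and> (\<forall>C\<in>F. is_clause C)"

definition vars :: "'v clauses \<Rightarrow> 'v set" where
  "vars F = (\<Union>C\<in>F. lit_var ` C)"

definition num_vars :: "'v clauses \<Rightarrow> nat" where
  "num_vars F = card (vars F)"

definition num_lits :: "'v clauses \<Rightarrow> nat" where
  "num_lits F = (\<Sum>C\<in>F. card C)"

type_synonym 'v passign = "'v \<rightharpoonup> bool"

fun lit_val :: "'v passign \<Rightarrow> 'v literal \<Rightarrow> bool option" where
  "lit_val \<phi> (Pos v) = \<phi> v"
| "lit_val \<phi> (Neg v) = map_option Not (\<phi> v)"

definition apply_pa :: "'v passign \<Rightarrow> 'v clauses \<Rightarrow> 'v clauses" where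
  "apply_pa \<phi> F =
     {{x \<in> C. lit_val \<phi> x \<noteq> Some False} | C. C \<in> F \<and> (\<forall>x\<in>C. lit_val \<phi> x \<noteq> Some True)}"

definition satisfiable :: "'v clauses \<Rightarrow> bool" where
  "satisfiable F \<longleftrightarrow> (\<exists>\<phi>. finite (dom \<phi>) \<and> apply_pa \<phi> F = {})"

fun set_true :: "'v literal \<Rightarrow> 'v passign" where
  "set_true (Pos v) = [v \<mapsto> True]"
| "set_true (Neg v) = [v \<mapsto> False]"

text \<open>The recursion terminates on clause-sets, since every step removes a variable. The unit
  clause is picked by Hilbert choice; the result does not depend on the choice.\<close>

partial_function (tailrec) r1 :: "'v clauses \<Rightarrow> 'v clauses" where
  "r1 F =
     (if {} \<in> F then {{}}
      else if \<forall>C\<in>F. card C \<ge> 2 then F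
      else r1 (apply_pa (set_true (SOME x. {x} \<in> F)) F))"

section \<open>Boolean functions and monotone circuits\<close>

text \<open>An $n$-ary boolean function is a function on boolean lists, considered only on lists of
  length $n$. The arguments of the monotonisation are ordered $v_1', v_1'', \ldots, v_n', v_n''$,
  so with indices from 0 on, $v_i'$ and $v_i''$ are at positions $2i$ and $2i+1$.\<close>

definition monotonisation :: "nat \<Rightarrow> (bool list \<Rightarrow> bool) \<Rightarrow> bool list \<Rightarrow> bool" where
  "monotonisation n f ys \<longleftrightarrow>
     (\<exists>xs. length xs = n \<and> f xs \<and>
        (\<forall>i<n. (\<not> xs ! i \<longrightarrow> ys ! (2 * i)) \<and> (xs ! i \<longrightarrow> ys ! (2 * i + 1))))"

text \<open>A circuit is a list of nodes in topological order, where operands are referred to by their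
  position in the list; the last node is the output. Constant sources are included because a
  constant function has no circuit consisting of input nodes and binary gates only.\<close>

datatype gate = InputG nat | ConstG bool | AndG nat nat | OrG nat nat

type_synonym circuit = "gate list"

fun wf_gate :: "nat \<Rightarrow> nat \<Rightarrow> gate \<Rightarrow> bool" where
  "wf_gate m k (InputG i) \<longleftrightarrow> i < m"
| "wf_gate m k (ConstG b) \<longleftrightarrow> True"
| "wf_gate m k (AndG i j) \<longleftrightarrow> i < k \<and> j < k"
| "wf_gate m k (OrG i j) \<longleftrightarrow> i < k \<and> j < k"

definition wf_circuit :: "nat \<Rightarrow> circuit \<Rightarrow> bool" where
  "wf_circuit m Q \<longleftrightarrow> Q \<noteq> [] \<and> (\<forall>k<length Q. wf_gate m k (Q ! k))"

fun gate_val :: "bool list \<Rightarrow> bool list \<Rightarrow> gate \<Rightarrow> bool" where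
  "gate_val ys vs (InputG i) = ys ! i"
| "gate_val ys vs (ConstG b) = b"
| "gate_val ys vs (AndG i j) = (vs ! i \<and> vs ! j)"
| "gate_val ys vs (OrG i j) = (vs ! i \<or> vs ! j)"

definition gate_vals :: "bool list \<Rightarrow> circuit \<Rightarrow> bool list" where
  "gate_vals ys Q = foldl (\<lambda>vs g. vs @ [gate_val ys vs g]) [] Q"

definition circuit_val :: "circuit \<Rightarrow> bool list \<Rightarrow> bool" where
  "circuit_val Q ys = last (gate_vals ys Q)"

definition circuit_computes :: "circuit \<Rightarrow> nat \<Rightarrow> (bool list \<Rightarrow> bool) \<Rightarrow> bool" where
  "circuit_computes Q m g \<longleftrightarrow>
     wf_circuit m Q \<and> (\<forall>ys. length ys = m \<longrightarrow> circuit_val Q ys = g ys)"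

definition is_constant :: "nat \<Rightarrow> (bool list \<Rightarrow> bool) \<Rightarrow> bool" where
  "is_constant m g \<longleftrightarrow> (\<exists>b. \<forall>ys. length ys = m \<longrightarrow> g ys = b)"

section \<open>Random access machine\<close>

text \<open>Time is measured on a unit-cost random access machine with addition and subtraction
  (but no multiplication), programmed by while-programs. A program uses finitely many scalar
  registers and finitely many unbounded arrays, so up to a constant factor this is the usual
  machine with a single memory.\<close>

datatype aexp =
    Num int
  | Var string
  | Get string aexp
  | Plus aexp aexp
  | Minus aexp aexp

datatype bexp =
    Less aexp aexp
  | Equal aexp aexp
  | Neg_b bexp
  | Conj bexp bexp

datatype com =
    Skip
  | Assign string aexp
  | Store string aexp aexp
  | Seq com com
  | Cond bexp com com
  | While bexp com

record state =
  scalar :: "string \<Rightarrow> int"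
  arr :: "string \<Rightarrow> int \<Rightarrow> int"

fun aval :: "aexp \<Rightarrow> state \<Rightarrow> int" where
  "aval (Num k) s = k"
| "aval (Var x) s = scalar s x"
| "aval (Get a e) s = arr s a (aval e s)"
| "aval (Plus e1 e2) s = aval e1 s + aval e2 s"
| "aval (Minus e1 e2) s = aval e1 s - aval e2 s"

fun acost :: "aexp \<Rightarrow> nat" where
  "acost (Num k) = 1"
| "acost (Var x) = 1"
| "acost (Get a e) = 1 + acost e"
| "acost (Plus e1 e2) = 1 + acost e1 + acost e2"
| "acost (Minus e1 e2) = 1 + acost e1 + acost e2"

fun bval :: "bexp \<Rightarrow> state \<Rightarrow> bool" where
  "bval (Less e1 e2) s \<longleftrightarrow> aval e1 s < aval e2 s"
| "bval (Equal e1 e2) s \<longleftrightarrow> aval e1 s = aval e2 s"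
| "bval (Neg_b b) s \<longleftrightarrow> \<not> bval b s"
| "bval (Conj b1 b2) s \<longleftrightarrow> bval b1 s \<and> bval b2 s"

fun bcost :: "bexp \<Rightarrow> nat" where
  "bcost (Less e1 e2) = 1 + acost e1 + acost e2"
| "bcost (Equal e1 e2) = 1 + acost e1 + acost e2"
| "bcost (Neg_b b) = 1 + bcost b"
| "bcost (Conj b1 b2) = 1 + bcost b1 + bcost b2"

text \<open>\<open>exec p s t s'\<close>: program \<open>p\<close> started in state \<open>s\<close> halts in state \<open>s'\<close> after
  exactly \<open>t\<close> steps.\<close>

inductive exec :: "com \<Rightarrow> state \<Rightarrow> nat \<Rightarrow> state \<Rightarrow> bool" where
  exec_Skip: "exec Skip s 1 s"
| exec_Assign:
    "exec (Assign x e) s (1 + acost e) (s\<lparr>scalar := (scalar s)(x := aval e s)\<rparr>)"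
| exec_Store:
    "exec (Store a i e) s (1 + acost i + acost e)
       (s\<lparr>arr := (arr s)(a := (arr s a)(aval i s := aval e s))\<rparr>)"
| exec_Seq:
    "exec p s t1 s' \<Longrightarrow> exec q s' t2 s'' \<Longrightarrow> exec (Seq p q) s (t1 + t2) s''"
| exec_CondTrue:
    "bval b s \<Longrightarrow> exec p s t s' \<Longrightarrow> exec (Cond b p q) s (1 + bcost b + t) s'"
| exec_CondFalse:
    "\<not> bval b s \<Longrightarrow> exec q s t s' \<Longrightarrow> exec (Cond b p q) s (1 + bcost b + t) s'"
| exec_WhileFalse:
    "\<not> bval b s \<Longrightarrow> exec (While b p) s (1 + bcost b) s"
| exec_WhileTrue:
    "bval b s \<Longrightarrow> exec p s t1 s' \<Longrightarrow> exec (While b p) s' t2 s'' \<Longrightarrow>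
     exec (While b p) s (1 + bcost b + t1 + t2) s''"

definition init_state :: "int list \<Rightarrow> state" where
  "init_state xs =
     \<lparr>scalar = (\<lambda>_. 0),
      arr = (\<lambda>a i. if a = ''input'' \<and> 0 \<le> i \<and> i < int (length xs) then xs ! nat i else 0)\<rparr>"

definition has_output :: "state \<Rightarrow> int list \<Rightarrow> bool" where
  "has_output s xs \<longleftrightarrow> (\<forall>i<length xs. arr s ''output'' (int i) = xs ! i)"

section \<open>Encoding of inputs and outputs\<close>

text \<open>Variables are natural numbers. A clause-set is given to the machine by listing its clauses,
  and the literals of each clause, in any order and without repetition.\<close>

definition lists_clause_set :: "nat literal list list \<Rightarrow> nat clauses \<Rightarrow> bool" where
  "lists_clause_set L F \<longleftrightarrow>
     set (map set L) = F \<and> distinct (map set L) \<and> (\<forall>c\<in>set L. distinct c)"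

text \<open>Literals are encoded as in the DIMACS format, i.e., by nonzero integers with negation as
  sign change, and clauses are terminated by 0.\<close>

fun enc_lit :: "nat literal \<Rightarrow> int" where
  "enc_lit (Pos v) = int v + 1"
| "enc_lit (Neg v) = - (int v + 1)"

definition enc_input :: "nat list \<Rightarrow> nat literal list list \<Rightarrow> int list" where
  "enc_input vs L =
     [int (length vs)] @ map (\<lambda>v. int v + 1) vs @
     [int (length L)] @ concat (map (\<lambda>c. map enc_lit c @ [0]) L)"

fun enc_gate :: "gate \<Rightarrow> int list" where
  "enc_gate (InputG i) = [0, int i, 0]"
| "enc_gate (ConstG b) = [1, of_bool b, 0]"
| "enc_gate (AndG i j) = [2, int i, int j]"
| "enc_gate (OrG i j) = [3, int i, int j]"

definition enc_circuit :: "circuit \<Rightarrow> int list" where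
  "enc_circuit Q = [int (length Q)] @ concat (map enc_gate Q)"

end

theory Submission
  imports Defs
begin

text \<open>The circuit simulates unit-clause propagation on \<open>F\<close> together with the unit clauses \<open>v\<close> for
  \<open>v' = 0\<close> and \<open>\<not> v\<close> for \<open>v'' = 0\<close>. The signal ``literal \<open>x\<close> has not been derived'' is
  monotone in the inputs: it is updated to its conjunction with the disjunction, over the other
  literals \<open>z\<close> of a clause containing \<open>x\<close>, of the signals of the complements of \<open>z\<close>. Every round over
  all clauses derives a new literal or reaches a fixed point, so a linear number of rounds suffices,
  each of which costs a factor clause length, at most \<open>n(F)\<close>, per literal occurrence. The empty
  clause is then not derived iff the partial assignment encoded by the inputs is consistent with
  \<open>f\<close>; inputs with \<open>v' = v'' = 0\<close> are filtered out separately.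

  A monotone circuit without constants is false on the zero vector and true on the one vector, as is
  the monotonisation if it is not constant. So it does not matter that the gates
  serving as constants are wrong on these two vectors.\<close>

section \<open>Running times of while-programs\<close>

text \<open>The program itself has to find out whether a constant may be output. The monotonisation
  is monotone, so its value at the vector of ones tells whether it is identically false; there no
  variable is assigned and the propagation is that of \<open>F\<close> alone, which can be run on
  numbers while the gates are written. Hence the array \<open>D\<close>, and hence invariants about
  a family \<open>N ys\<close> of propagation states: mixed \<open>ys\<close> describe the gates,
  the vector of ones describes \<open>D\<close>.

  That a fixed point decides the empty clause is proved by two different arguments, matching the
  dichotomy in the hypothesis. If \<open>apply_pa \<phi> F\<close> is satisfiable, every derived
  literal is true in a model extending \<open>\<phi>\<close>, so the empty clause is not derived.
  Otherwise a run of \<open>r1\<close> is followed inside the set of derived literals, which at a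
  fixed point is closed under unit resolution.\<close>

definition wp :: "com \<Rightarrow> state \<Rightarrow> (nat \<Rightarrow> state \<Rightarrow> bool) \<Rightarrow> bool" where
  "wp p s Q \<longleftrightarrow> (\<exists>t s'. exec p s t s' \<and> Q t s')"

inductive_cases exec_SkipE: "exec Skip s t s'"
inductive_cases exec_AssignE: "exec (Assign x e) s t s'"
inductive_cases exec_StoreE: "exec (Store a i e) s t s'"
inductive_cases exec_SeqE: "exec (Seq p q) s t s'"
inductive_cases exec_CondE: "exec (Cond b p q) s t s'"

text \<open>The running time is an argument of the postcondition and the rules are equivalences, so
  the simplifier executes loop-free code symbolically and adds up its exact cost.\<close>

lemma wp_Skip [simp]: "wp Skip s Q \<longleftrightarrow> Q 1 s"
  unfolding wp_def by (metis exec_Skip exec_SkipE)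

lemma wp_Assign [simp]:
  "wp (Assign x e) s Q \<longleftrightarrow> Q (1 + acost e) (s\<lparr>scalar := (scalar s)(x := aval e s)\<rparr>)"
  unfolding wp_def by (metis exec_Assign exec_AssignE)

lemma wp_Store [simp]:
  "wp (Store a i e) s Q \<longleftrightarrow>
     Q (1 + acost i + acost e) (s\<lparr>arr := (arr s)(a := (arr s a)(aval i s := aval e s))\<rparr>)"
  unfolding wp_def by (metis exec_Store exec_StoreE)

lemma wp_Seq [simp]:
  "wp (Seq p q) s Q \<longleftrightarrow> wp p s (\<lambda>t s'. wp q s' (\<lambda>t' s''. Q (t + t') s''))"
  unfolding wp_def by (blast intro: exec_Seq elim: exec_SeqE)

lemma wp_Cond [simp]:
  "wp (Cond b p q) s Q \<longleftrightarrow> wp (if bval b s then p else q) s (\<lambda>t s'. Q (1 + bcost b + t) s')"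
proof
  assume "wp (Cond b p q) s Q"
  then obtain t s' where "exec (Cond b p q) s t s'" "Q t s'"
    unfolding wp_def by blast
  then show "wp (if bval b s then p else q) s (\<lambda>t s'. Q (1 + bcost b + t) s')"
    unfolding wp_def by (elim exec_CondE) auto
next
  assume "wp (if bval b s then p else q) s (\<lambda>t s'. Q (1 + bcost b + t) s')"
  then show "wp (Cond b p q) s Q"
    unfolding wp_def by (cases "bval b s") (fastforce dest: exec_CondTrue exec_CondFalse)+
qed

lemma wp_mono: "wp p s Q \<Longrightarrow> (\<And>t s'. Q t s' \<Longrightarrow> Q' t s') \<Longrightarrow> wp p s Q'"
  unfolding wp_def by blast

text \<open>For loops whose number of iterations is known in advance; the invariant carries the
  iteration count. \<open>d\<close> and \<open>e\<close> are given by equations so that bounds can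
  be stated with evaluated numerals.\<close>

lemma wp_for:
  assumes start: "I 0 s"
    and step: "\<And>i s. i < M \<Longrightarrow> I i s \<Longrightarrow> bval b s \<and> wp p s (\<lambda>t s'. t \<le> c \<and> I (Suc i) s')"
    and stop: "\<And>s. I M s \<Longrightarrow> \<not> bval b s"
    and cost: "d = 1 + bcost b + c" "e = 1 + bcost b"
  shows "wp (While b p) s (\<lambda>t s'. t \<le> M * d + e \<and> I M s')"
proof -
  \<comment> \<open>Generalised to the remaining \<open>M - i\<close> iterations; the induction runs
    downwards from \<open>M\<close>.\<close>
  have "wp (While b p) s (\<lambda>t s'. t \<le> (M - i) * (1 + bcost b + c) + (1 + bcost b) \<and> I M s')"
    if "i \<le> M" "I i s" for i s
    using that
  proof (induction i arbitrary: s rule: inc_induct)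
    case base
    then show ?case
      unfolding wp_def using stop exec_WhileFalse by fastforce
  next
    case (step i)
    have b: "bval b s" and w: "wp p s (\<lambda>t s'. t \<le> c \<and> I (Suc i) s')"
      using assms(2) step.hyps step.prems by auto
    from w obtain t1 s1 where 1: "exec p s t1 s1" "t1 \<le> c" "I (Suc i) s1"
      unfolding wp_def by blast
    from step.IH[OF 1(3)] obtain t2 s2 where
      2: "exec (While b p) s1 t2 s2" "t2 \<le> (M - Suc i) * (1 + bcost b + c) + (1 + bcost b)" "I M s2"
      unfolding wp_def by blast
    have "M - i = Suc (M - Suc i)" using step.hyps by simp
    then have "1 + bcost b + t1 + t2 \<le> (M - i) * (1 + bcost b + c) + (1 + bcost b)"
      using 1(2) 2(2) by simp
    then show ?case
      unfolding wp_def using exec_WhileTrue[OF b 1(1) 2(1)] 2(3) by blast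
  qed
  from this[of 0, OF _ start] show ?thesis by (simp add: cost)
qed

section \<open>The circuit-generating program\<close>

abbreviation seq :: "com \<Rightarrow> com \<Rightarrow> com" (infixr ";;" 60) where
  "p ;; q \<equiv> Seq p q"

abbreviation "neg e \<equiv> Minus (Num 0) e"
abbreviation "thrice e \<equiv> Plus e (Plus e e)"

definition push :: "int \<Rightarrow> aexp \<Rightarrow> aexp \<Rightarrow> com" where
  "push opc a b =
     Store ''output'' (Plus (thrice (Var ''k'')) (Num 1)) (Num opc) ;;
     Store ''output'' (Plus (thrice (Var ''k'')) (Num 2)) a ;;
     Store ''output'' (Plus (thrice (Var ''k'')) (Num 3)) b ;;
     Assign ''k'' (Plus (Var ''k'') (Num 1))"

text \<open>Cell 0 is reserved for the number of gates, which shifts every gate by one cell.\<close>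

definition put_gate :: "int \<Rightarrow> int \<Rightarrow> int \<Rightarrow> int \<Rightarrow> (int \<Rightarrow> int) \<Rightarrow> int \<Rightarrow> int" where
  "put_gate opc a b k out = out(3 * k + 1 := opc, 3 * k + 2 := a, 3 * k + 3 := b)"

text \<open>The assumptions keep the operands independent of the array being written:
  \<open>b\<close> is evaluated after two stores. Both operands are evaluated before
  \<open>k\<close> is increased, so \<open>k - 1\<close> in an operand denotes the latest
  gate.\<close>

lemma wp_push [simp]:
  assumes "\<And>X. aval a (s\<lparr>arr := (arr s)(''output'' := X)\<rparr>) = aval a s"
    and "\<And>X. aval b (s\<lparr>arr := (arr s)(''output'' := X)\<rparr>) = aval b s"
  shows "wp (push opc a b) s Q \<longleftrightarrow>
    Q (29 + acost a + acost b)
      (s\<lparr>arr := (arr s)(''output'' :=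
           put_gate opc (aval a s) (aval b s) (scalar s ''k'') (arr s ''output'')),
         scalar := (scalar s)(''k'' := scalar s ''k'' + 1)\<rparr>)"
  by (simp add: push_def put_gate_def assms algebra_simps numeral_eq_Suc)

text \<open>Gate \<open>T + cur[x]\<close> computes ``literal \<open>x\<close> has not been derived''. The offset \<open>T\<close> is the
  final position of the constant-true signal, so the default value \<open>0\<close> of an unset array entry
  already is correct. Each input variable contributes 7 gates; the final positions are \<open>T - 1\<close> for
  the signal ``no variable has both inputs 0'', \<open>T\<close> for true and \<open>T + 2\<close> for false. The
  registers \<open>acc\<close> and \<open>tt\<close> start at gate 2 and \<open>ff\<close> at gate 0, i.e., at gates of the first
  block that make the first conjunction or disjunction redundant.\<close>

definition read_input :: com where
  "read_input =
     Assign ''a'' (Get ''input'' (Plus (Var ''j'') (Num 1))) ;;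
     Store ''cur'' (Var ''a'') (Minus (Var ''k'') (Var ''T'')) ;;
     Store ''cur'' (neg (Var ''a'')) (Minus (Plus (Var ''k'') (Num 1)) (Var ''T'')) ;;
     push 0 (Plus (Var ''j'') (Var ''j'')) (Num 0) ;;
     push 0 (Plus (Plus (Var ''j'') (Var ''j'')) (Num 1)) (Num 0) ;;
     push 3 (Minus (Var ''k'') (Num 2)) (Minus (Var ''k'') (Num 1)) ;;
     push 2 (Var ''acc'') (Minus (Var ''k'') (Num 1)) ;;
     Assign ''acc'' (Minus (Var ''k'') (Num 1)) ;;
     push 3 (Var ''tt'') (Minus (Var ''k'') (Num 2)) ;;
     Assign ''tt'' (Minus (Var ''k'') (Num 1)) ;;
     push 2 (Var ''ff'') (Minus (Var ''k'') (Num 5)) ;;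
     push 2 (Minus (Var ''k'') (Num 1)) (Minus (Var ''k'') (Num 5)) ;;
     Assign ''ff'' (Minus (Var ''k'') (Num 1)) ;;
     Assign ''j'' (Plus (Var ''j'') (Num 1))"

definition build_inputs :: com where
  "build_inputs = While (Less (Var ''j'') (Var ''n'')) read_input"

text \<open>The number \<open>R\<close> of rounds exceeds the number of distinct literals by one, since the
  empty clause counts as a further derivable object.\<close>

definition scan_clauses :: com where
  "scan_clauses =
     While (Less (Num 0) (Var ''c''))
       (Cond (Equal (Get ''input'' (Var ''p'')) (Num 0))
          (Assign ''c'' (Minus (Var ''c'') (Num 1)))
          (Cond (Equal (Get ''mark'' (Get ''input'' (Var ''p''))) (Num 0))
             (Store ''mark'' (Get ''input'' (Var ''p'')) (Num 1) ;;
              Assign ''R'' (Plus (Var ''R'') (Num 1)))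
             Skip) ;;
        Assign ''p'' (Plus (Var ''p'') (Num 1)))"

text \<open>Alongside the circuit, the array \<open>D\<close> records what is derived from \<open>F\<close> alone.\<close>

definition join_others :: com where
  "join_others =
     While (Neg_b (Equal (Get ''input'' (Var ''q'')) (Num 0)))
       (Cond (Equal (Var ''q'') (Var ''p''))
          Skip
          (push 3 (Var ''g'') (Plus (Var ''T'') (Get ''cur'' (neg (Get ''input'' (Var ''q''))))) ;;
           Assign ''g'' (Minus (Var ''k'') (Num 1)) ;;
           Cond (Equal (Get ''D'' (neg (Get ''input'' (Var ''q'')))) (Num 0))
             (Assign ''h'' (Num 0))
             Skip) ;;
        Assign ''q'' (Plus (Var ''q'') (Num 1)))"

text \<open>The terminator \<open>0\<close> of a clause is treated as a literal standing for the empty clause: it is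
  derived if all literals of the clause are falsified.\<close>

definition process_position :: com where
  "process_position =
     Assign ''g'' (Plus (Var ''T'') (Num 2)) ;;
     Assign ''h'' (Num 1) ;;
     Assign ''q'' (Var ''b'') ;;
     join_others ;;
     push 2 (Plus (Var ''T'') (Get ''cur'' (Get ''input'' (Var ''p'')))) (Var ''g'') ;;
     Store ''cur'' (Get ''input'' (Var ''p'')) (Minus (Minus (Var ''k'') (Num 1)) (Var ''T'')) ;;
     Cond (Equal (Var ''h'') (Num 1)) (Store ''D'' (Get ''input'' (Var ''p'')) (Num 1)) Skip ;;
     Cond (Equal (Get ''input'' (Var ''p'')) (Num 0))
       (Assign ''b'' (Plus (Var ''p'') (Num 1))) Skip ;;
     Assign ''p'' (Plus (Var ''p'') (Num 1))"

definition propagate :: com where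
  "propagate =
     While (Less (Var ''r'') (Var ''R''))
       (Assign ''p'' (Plus (Var ''n'') (Num 2)) ;;
        Assign ''b'' (Var ''p'') ;;
        While (Less (Var ''p'') (Var ''E'')) process_position ;;
        Assign ''r'' (Plus (Var ''r'') (Num 1)))"

text \<open>If \<open>f\<close> is unsatisfiable or has no variables, the output is overwritten by a constant.\<close>

definition finish :: com where
  "finish =
     push 2 (Plus (Var ''T'') (Get ''cur'' (Num 0))) (Minus (Var ''T'') (Num 1)) ;;
     Store ''output'' (Num 0) (Var ''k'') ;;
     Cond (Conj (Less (Num 0) (Var ''n'')) (Equal (Get ''D'' (Num 0)) (Num 0)))
       Skip
       (Store ''output'' (Num 0) (Num 1) ;;
        Store ''output'' (Num 1) (Num 1) ;;
        Store ''output'' (Num 2) (Minus (Num 1) (Get ''D'' (Num 0))) ;;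
        Store ''output'' (Num 3) (Num 0))"

definition circuit_program :: com where
  "circuit_program =
     Assign ''n'' (Get ''input'' (Num 0)) ;;
     Assign ''T'' (Minus (Plus (Var ''n'') (thrice (Plus (Var ''n'') (Var ''n'')))) (Num 3)) ;;
     Assign ''acc'' (Num 2) ;;
     Assign ''tt'' (Num 2) ;;
     build_inputs ;;
     Assign ''c'' (Get ''input'' (Plus (Var ''n'') (Num 1))) ;;
     Assign ''p'' (Plus (Var ''n'') (Num 2)) ;;
     Assign ''R'' (Num 1) ;;
     scan_clauses ;;
     Assign ''E'' (Var ''p'') ;;
     Assign ''r'' (Num 0) ;;
     propagate ;;
     finish"

section \<open>Circuits in the output array\<close>

text \<open>There is no case for the opcode of constants, so a decoded circuit is free of constants
  by construction. Stray opcodes fall into the default; \<open>valid_out\<close> excludes them by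
  requiring that encoding gives the cells back.\<close>

definition dec_gate :: "int \<Rightarrow> int \<Rightarrow> int \<Rightarrow> gate" where
  "dec_gate opc a b =
     (if opc = 0 then InputG (nat a)
      else if opc = 2 then AndG (nat a) (nat b) else OrG (nat a) (nat b))"

definition circuit_at :: "int \<Rightarrow> (int \<Rightarrow> int) \<Rightarrow> circuit" where
  "circuit_at k out =
     map (\<lambda>i. dec_gate (out (3 * int i + 1)) (out (3 * int i + 2)) (out (3 * int i + 3))) [0..<nat k]"

text \<open>Without input variables the positions \<open>T - 1\<close>, \<open>T\<close> and
  \<open>T + 2\<close> are negative and the array holds no circuit; \<open>finish\<close> then
  replaces it. The guard \<open>0 < m\<close> lets the invariants hold in that case too.\<close>

definition valid_out :: "nat \<Rightarrow> int \<Rightarrow> (int \<Rightarrow> int) \<Rightarrow> bool" where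
  "valid_out m k out \<longleftrightarrow> 0 \<le> k \<and> (0 < m \<longrightarrow>
     (\<forall>i<nat k. wf_gate m i (circuit_at k out ! i) \<and>
        enc_gate (circuit_at k out ! i) =
          [out (3 * int i + 1), out (3 * int i + 2), out (3 * int i + 3)]))"

text \<open>The disjunction and the conjunction of all inputs are used as true and false; this is
  only wrong on the two constant input vectors.\<close>

definition mixed :: "nat \<Rightarrow> bool list \<Rightarrow> bool" where
  "mixed m ys \<longleftrightarrow> length ys = m \<and> True \<in> set ys \<and> False \<in> set ys"

text \<open>Restricted to mixed vectors so that \<open>signal_cong\<close> can later replace the
  disjunction of all inputs by true and their conjunction by false.\<close>

definition signal :: "nat \<Rightarrow> int \<Rightarrow> (int \<Rightarrow> int) \<Rightarrow> int \<Rightarrow> (bool list \<Rightarrow> bool) \<Rightarrow> bool" where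
  "signal m k out x P \<longleftrightarrow> (0 < m \<longrightarrow> 0 \<le> x \<and> x < k \<and>
     (\<forall>ys. mixed m ys \<longrightarrow> gate_vals ys (circuit_at k out) ! nat x = P ys))"

lemma length_circuit_at [simp]: "length (circuit_at k out) = nat k"
  by (simp add: circuit_at_def)

lemma circuit_at_put:
  "0 \<le> k \<Longrightarrow> circuit_at (k + 1) (put_gate opc a b k out) = circuit_at k out @ [dec_gate opc a b]"
  by (rule nth_equalityI)
    (auto simp: circuit_at_def put_gate_def nth_append nat_add_distrib less_Suc_eq)

lemma gate_vals_snoc:
  "gate_vals ys (Q @ [g]) = gate_vals ys Q @ [gate_val ys (gate_vals ys Q) g]"
  by (simp add: gate_vals_def)

lemma length_gate_vals [simp]: "length (gate_vals ys Q) = length Q"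
  by (induction Q rule: rev_induct) (simp_all add: gate_vals_snoc, simp add: gate_vals_def)

lemma signal_put:
  assumes "signal m k out x P"
  shows "signal m (k + 1) (put_gate opc a b k out) x P"
  using assms by (auto simp: signal_def circuit_at_put gate_vals_snoc nth_append)

lemma signal_cong:
  assumes "signal m k out x P" "\<And>ys. mixed m ys \<Longrightarrow> P ys = P' ys"
  shows "signal m k out x P'"
  using assms by (auto simp: signal_def)

lemma signal_input:
  assumes "0 \<le> k" "opc = 0"
  shows "signal m (k + 1) (put_gate opc a b k out) k (\<lambda>ys. ys ! nat a)"
  using assms by (auto simp: signal_def circuit_at_put gate_vals_snoc nth_append dec_gate_def)

lemma signal_and:
  assumes "0 \<le> k" "signal m k out a P" "signal m k out b P'" 
  shows "signal m (k + 1) (put_gate 2 a b k out) k (\<lambda>ys. P ys \<and> P' ys)"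
  using assms by (auto simp: signal_def circuit_at_put gate_vals_snoc nth_append dec_gate_def)

lemma signal_or:
  assumes "0 \<le> k" "signal m k out a P" "signal m k out b P'" 
  shows "signal m (k + 1) (put_gate 3 a b k out) k (\<lambda>ys. P ys \<or> P' ys)"
  using assms by (auto simp: signal_def circuit_at_put gate_vals_snoc nth_append dec_gate_def)

lemma valid_out_put:
  assumes "valid_out m k out"
    and "0 < m \<Longrightarrow> wf_gate m (nat k) (dec_gate opc a b)"
    and "0 < m \<Longrightarrow> enc_gate (dec_gate opc a b) = [opc, a, b]"
  shows "valid_out m (k + 1) (put_gate opc a b k out)"
proof -
  have k: "0 \<le> k" using assms(1) by (simp add: valid_out_def)
  show ?thesis
    unfolding valid_out_def circuit_at_put[OF k]
    using assms k
    by (auto simp: valid_out_def nat_add_distrib less_Suc_eq nth_append put_gate_def)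
qed

lemma valid_out_input:
  assumes "valid_out m k out" "0 \<le> a" "a < int m"
  shows "valid_out m (k + 1) (put_gate 0 a 0 k out)"
  using assms by (intro valid_out_put) (auto simp: dec_gate_def)

lemma valid_out_binary:
  assumes "valid_out m k out" "signal m k out a P" "signal m k out b P'" "opc \<in> {2, 3}"
  shows "valid_out m (k + 1) (put_gate opc a b k out)"
  using assms by (intro valid_out_put) (auto simp: dec_gate_def signal_def)

section \<open>Propagation on encoded clauses\<close>

definition code_stream :: "int list list \<Rightarrow> int list" where
  "code_stream cs = concat (map (\<lambda>c. c @ [0]) cs)"

definition positions :: "int list list \<Rightarrow> (int list \<times> nat) list" where
  "positions cs = concat (map (\<lambda>c. map (Pair c) [0..<Suc (length c)]) cs)"

text \<open>The bound \<open>l\<close> makes this the invariant of the inner loop after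
  \<open>l\<close> literals. For \<open>i = length c\<close> no literal is excluded, so the same
  formula serves the terminator.\<close>

definition others_alive :: "int list \<Rightarrow> nat \<Rightarrow> nat \<Rightarrow> (int \<Rightarrow> bool) \<Rightarrow> bool" where
  "others_alive c i l N \<longleftrightarrow> (\<exists>j<l. j \<noteq> i \<and> N (- (c ! j)))"

lemma others_alive_simps [simp]:
  "\<not> others_alive c i 0 N"
  "others_alive c i (Suc l) N \<longleftrightarrow> others_alive c i l N \<or> l \<noteq> i \<and> N (- (c ! l))"
  by (auto simp: others_alive_def less_Suc_eq)

text \<open>\<open>N x\<close> means that literal \<open>x\<close> is not yet derived; position \<open>length c\<close> of clause \<open>c\<close> is its
  terminator.\<close>

fun update :: "int list \<times> nat \<Rightarrow> (int \<Rightarrow> bool) \<Rightarrow> int \<Rightarrow> bool" where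
  "update (c, i) N =
     N((c @ [0]) ! i := N ((c @ [0]) ! i) \<and> others_alive c i (length c) N)"

text \<open>The updates are sequential because \<open>cur\<close> is overwritten in place: a literal
  derived early in a sweep is already used later in the same sweep.\<close>

definition sweep :: "int list list \<Rightarrow> (int \<Rightarrow> bool) \<Rightarrow> int \<Rightarrow> bool" where
  "sweep cs = fold update (positions cs)"

definition initial :: "nat list \<Rightarrow> nat \<Rightarrow> bool list \<Rightarrow> int \<Rightarrow> bool" where
  "initial vs j ys x \<longleftrightarrow>
     (\<forall>i<j. (x = int (vs ! i) + 1 \<longrightarrow> ys ! (2 * i)) \<and> (x = - (int (vs ! i) + 1) \<longrightarrow> ys ! (2 * i + 1)))"

lemma length_positions: "length (positions cs) = length (code_stream cs)"
  by (induction cs) (simp_all add: positions_def code_stream_def)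

text \<open>The machine sees only the flat stream. \<open>m - i\<close> is where the clause of
  position \<open>m\<close> begins, the value kept in register \<open>b\<close>.\<close>

lemma positions_nth:
  assumes "m < length (positions cs)" "positions cs ! m = (c, i)"
  shows "c \<in> set cs \<and> i \<le> length c \<and> i \<le> m \<and>
    (\<forall>j\<le>length c. m - i + j < length (code_stream cs) \<and> code_stream cs ! (m - i + j) = (c @ [0]) ! j)"
  using assms
proof (induction cs arbitrary: m)
  case Nil
  then show ?case by (simp add: positions_def)
next
  case (Cons d cs)
  have pos: "positions (d # cs) = map (Pair d) [0..<Suc (length d)] @ positions cs"
    and str: "code_stream (d # cs) = (d @ [0]) @ code_stream cs"
    by (simp_all add: positions_def code_stream_def)
  show ?case
  proof (cases "m < Suc (length d)")
    case True
    then have "c = d" "i = m"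
      using Cons.prems(2) by (auto simp: pos nth_append simp del: upt_Suc)
    then show ?thesis
      using True by (auto simp: str nth_append)
  next
    case False
    define m' where "m' = m - Suc (length d)"
    have m: "m = Suc (length d) + m'" using False by (simp add: m'_def)
    have "m' < length (positions cs)" "positions cs ! m' = (c, i)"
      using Cons.prems by (simp_all add: pos m nth_append del: upt_Suc)
    then have IH: "c \<in> set cs \<and> i \<le> length c \<and> i \<le> m' \<and>
      (\<forall>j\<le>length c. m' - i + j < length (code_stream cs) \<and> code_stream cs ! (m' - i + j) = (c @ [0]) ! j)"
      by (rule Cons.IH)
    then have "i \<le> m'" by blast
    then have "m - i + j = length (d @ [0]) + (m' - i + j)" for j unfolding m by simp
    then have shift: "code_stream (d # cs) ! (m - i + j) = code_stream cs ! (m' - i + j)"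
        "m - i + j < length (code_stream (d # cs)) \<longleftrightarrow> m' - i + j < length (code_stream cs)" for j
      unfolding str by (simp_all only: nth_append_length_plus) simp
    have "\<forall>j\<le>length c. m - i + j < length (code_stream (d # cs)) \<and>
        code_stream (d # cs) ! (m - i + j) = (c @ [0]) ! j"
      unfolding shift using IH by blast
    then show ?thesis
      using IH m by auto
  qed
qed

lemma positions_start: "0 < length (positions cs) \<Longrightarrow> snd (positions cs ! 0) = 0"
  by (cases cs) (simp_all add: positions_def nth_append del: upt_Suc)

lemma positions_next:
  assumes "Suc m < length (positions cs)" "positions cs ! m = (c, i)"
  shows "if i < length c then positions cs ! Suc m = (c, Suc i) else snd (positions cs ! Suc m) = 0"
  using assms
proof (induction cs arbitrary: m)
  case Nil
  then show ?case by (simp add: positions_def)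
next
  case (Cons d cs)
  have pos: "positions (d # cs) = map (Pair d) [0..<Suc (length d)] @ positions cs"
    by (simp_all add: positions_def)
  show ?case
  proof (cases "m < Suc (length d)")
    case True
    then have ci: "c = d" "i = m"
      using Cons.prems(2) by (auto simp: pos nth_append simp del: upt_Suc)
    show ?thesis
    proof (cases "m < length d")
      case True
      then show ?thesis using ci by (auto simp: pos nth_append simp del: upt_Suc)
    next
      case False
      then have "m = length d" using True by simp
      then show ?thesis
        using ci Cons.prems(1) positions_start[of cs] by (simp add: pos nth_append del: upt_Suc)
    qed
  next
    case False
    define m' where "m' = m - Suc (length d)"
    have m: "m = Suc (length d) + m'" using False by (simp add: m'_def)
    then show ?thesis
      using Cons.IH[of m'] Cons.prems by (simp add: pos nth_append del: upt_Suc split: if_splits)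
  qed
qed

lemma fold_take_Suc:
  "m < length ps \<Longrightarrow> fold f (take (Suc m) ps) a = f (ps ! m) (fold f (take m ps) a)"
  by (simp add: take_Suc_conv_app_nth)

section \<open>Gates contributed by the input variables\<close>

lemma all_less_double:
  "(\<forall>i<2 * Suc j. P i) \<longleftrightarrow> (\<forall>i<2 * j. P i) \<and> P (2 * j) \<and> P (2 * j + 1)" for j :: nat
  by (simp add: All_less_Suc conj_comms)

lemma ex_less_double:
  "(\<exists>i<2 * Suc j. P i) \<longleftrightarrow> (\<exists>i<2 * j. P i) \<or> P (2 * j) \<or> P (2 * j + 1)" for j :: nat
  by (auto simp add: Ex_less_Suc)

text \<open>Before the first block the three registers name gates that do not exist yet, so for
  \<open>j = 0\<close> no signal can be asserted. The offsets 4, 3 and 1 are the places of the three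
  gates in a block of 7, counted from its end.\<close>

definition prefix_ok ::
  "nat \<Rightarrow> nat \<Rightarrow> int \<Rightarrow> (int \<Rightarrow> int) \<Rightarrow> int \<Rightarrow> int \<Rightarrow> int \<Rightarrow> bool" where
  "prefix_ok m j k out acc tt ff \<longleftrightarrow> valid_out m k out \<and> k = 7 * int j \<and>
     (if j = 0 then acc = 2 \<and> tt = 2 \<and> ff = 0
      else acc = k - 4 \<and> tt = k - 3 \<and> ff = k - 1 \<and>
        signal m k out acc (\<lambda>ys. \<forall>i<j. ys ! (2 * i) \<or> ys ! (2 * i + 1)) \<and>
        signal m k out tt (\<lambda>ys. \<exists>i<2 * j. ys ! i) \<and>
        signal m k out ff (\<lambda>ys. \<forall>i<2 * j. ys ! i))"

text \<open>Written in the shape that the simplifier produces when executing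
  \<open>read_input\<close>, so that the nested updates can be folded into one term.\<close>

definition input_gates ::
  "nat \<Rightarrow> int \<Rightarrow> int \<Rightarrow> int \<Rightarrow> int \<Rightarrow> (int \<Rightarrow> int) \<Rightarrow> int \<Rightarrow> int" where
  "input_gates j acc tt ff k out =
     put_gate 2 (5 + k) (k + 1) (6 + k) (put_gate 2 ff k (5 + k)
       (put_gate 3 tt (2 + k) (4 + k) (put_gate 2 acc (2 + k) (3 + k)
         (put_gate 3 k (k + 1) (2 + k) (put_gate 0 (2 * int j + 1) 0 (k + 1)
           (put_gate 0 (2 * int j) 0 k out))))))"

lemma prefix_ok_step:
  assumes ok: "prefix_ok m j k out acc tt ff" and j: "Suc (2 * j) < m"
  defines "out' \<equiv> input_gates j acc tt ff k out"
  shows "prefix_ok m (Suc j) (7 + k) out' (3 + k) (4 + k) (6 + k)"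
    and "signal m (7 + k) out' k (\<lambda>ys. ys ! (2 * j))"
    and "signal m (7 + k) out' (1 + k) (\<lambda>ys. ys ! (2 * j + 1))"
    and "signal m k out x P \<Longrightarrow> signal m (7 + k) out' x P"
proof -
  define o1 where "o1 = put_gate 0 (2 * int j) 0 k out"
  define o2 where "o2 = put_gate 0 (2 * int j + 1) 0 (k + 1) o1"
  define o3 where "o3 = put_gate 3 k (k + 1) (k + 2) o2"
  define o4 where "o4 = put_gate 2 acc (k + 2) (k + 3) o3"
  define o5 where "o5 = put_gate 3 tt (k + 2) (k + 4) o4"
  define o6 where "o6 = put_gate 2 ff k (k + 5) o5"
  have out': "out' = put_gate 2 (k + 5) (k + 1) (k + 6) o6"
    by (simp add: out'_def input_gates_def add.commute[of _ k] o1_def o2_def o3_def o4_def o5_def o6_def)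
  have valid: "valid_out m k out" and k: "k = 7 * int j"
    using ok unfolding prefix_ok_def by blast+
  have k0: "0 \<le> k" using k by simp
  have up1: "signal m (k + 1) o1 x P" if "signal m k out x P" for x P
    using signal_put[OF that] by (simp add: o1_def)
  have up2: "signal m (k + 2) o2 x P" if "signal m (k + 1) o1 x P" for x P
    using signal_put[OF that] by (simp add: o2_def add.assoc)
  have up3: "signal m (k + 3) o3 x P" if "signal m (k + 2) o2 x P" for x P
    using signal_put[OF that] by (simp add: o3_def add.assoc)
  have up4: "signal m (k + 4) o4 x P" if "signal m (k + 3) o3 x P" for x P
    using signal_put[OF that] by (simp add: o4_def add.assoc)
  have up5: "signal m (k + 5) o5 x P" if "signal m (k + 4) o4 x P" for x P
    using signal_put[OF that] by (simp add: o5_def add.assoc)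
  have up6: "signal m (k + 6) o6 x P" if "signal m (k + 5) o5 x P" for x P
    using signal_put[OF that] by (simp add: o6_def add.assoc)
  have up7: "signal m (k + 7) out' x P" if "signal m (k + 6) o6 x P" for x P
    using signal_put[OF that] by (simp add: out' add.assoc)
  note up = up1 up2 up3 up4 up5 up6 up7
  let ?y = "\<lambda>ys. ys ! (2 * j)" and ?z = "\<lambda>ys. ys ! (2 * j + 1)"
  have s0: "signal m (k + 1) o1 k ?y"
    using signal_input[OF k0, of 0 m "2 * int j" 0 out] by (simp add: o1_def nat_mult_distrib)
  have s1: "signal m (k + 2) o2 (k + 1) ?z"
    using signal_input[of "k + 1" 0 m "2 * int j + 1" 0 o1] k0
    by (simp add: o2_def nat_add_distrib nat_mult_distrib add.assoc)
  have s2: "signal m (k + 3) o3 (k + 2) (\<lambda>ys. ?y ys \<or> ?z ys)"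
    using signal_or[OF _ up2[OF s0] s1] k0 by (simp add: o3_def add.assoc)
  \<comment> \<open>For \<open>j = 0\<close>, \<open>acc\<close> is gate \<open>k + 2\<close>, the
    disjunction just written, and its conjunction with itself is harmless. The register
    \<open>tt\<close> below is treated alike.\<close>
  obtain PA where PA: "signal m (k + 3) o3 acc PA"
      "\<And>ys. PA ys \<and> (?y ys \<or> ?z ys) \<longleftrightarrow> (\<forall>i<Suc j. ys ! (2 * i) \<or> ys ! (2 * i + 1))"
  proof (cases "j = 0")
    case True
    then have "acc = k + 2" using ok k by (simp add: prefix_ok_def)
    with s2 True show ?thesis by (intro that[of "\<lambda>ys. ?y ys \<or> ?z ys"]) auto
  next
    case False
    then show ?thesis
      using ok by (intro that[of "\<lambda>ys. \<forall>i<j. ys ! (2 * i) \<or> ys ! (2 * i + 1)"] up)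
        (auto simp: prefix_ok_def less_Suc_eq)
  qed
  obtain PT where PT: "signal m (k + 4) o4 tt PT"
      "\<And>ys. PT ys \<or> (?y ys \<or> ?z ys) \<longleftrightarrow> (\<exists>i<2 * j. ys ! i) \<or> ?y ys \<or> ?z ys"
  proof (cases "j = 0")
    case True
    then have "tt = k + 2" using ok k by (simp add: prefix_ok_def)
    with s2 True show ?thesis
      by (intro that[of "\<lambda>ys. ?y ys \<or> ?z ys"] up4) auto
  next
    case False
    then show ?thesis
      using ok by (intro that[of "\<lambda>ys. \<exists>i<2 * j. ys ! i"] up) (auto simp: prefix_ok_def)
  qed
  \<comment> \<open>For \<open>j = 0\<close>, \<open>ff\<close> is gate \<open>k\<close>, the first
    input itself, so that conjunct is merely repeated.\<close>
  obtain PF where PF: "signal m (k + 5) o5 ff PF"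
      "\<And>ys. (PF ys \<and> ?y ys) \<and> ?z ys \<longleftrightarrow> (\<forall>i<2 * j. ys ! i) \<and> ?y ys \<and> ?z ys"
  proof (cases "j = 0")
    case True
    then have "ff = k" using ok k by (simp add: prefix_ok_def)
    with s0 True show ?thesis
      by (intro that[of ?y] up5 up4 up3 up2) auto
  next
    case False
    then show ?thesis
      using ok by (intro that[of "\<lambda>ys. \<forall>i<2 * j. ys ! i"] up) (auto simp: prefix_ok_def)
  qed
  have s3: "signal m (k + 4) o4 (k + 3) (\<lambda>ys. \<forall>i<Suc j. ys ! (2 * i) \<or> ys ! (2 * i + 1))"
    using signal_and[OF _ PA(1) s2] k0 unfolding PA(2) by (simp add: o4_def add.assoc)
  have s4: "signal m (k + 5) o5 (k + 4) (\<lambda>ys. \<exists>i<2 * Suc j. ys ! i)"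
    using signal_or[OF _ PT(1) up4[OF s2]] k0 unfolding PT(2) ex_less_double[symmetric] by (simp add: o5_def add.assoc)
  have s5: "signal m (k + 6) o6 (k + 5) (\<lambda>ys. PF ys \<and> ?y ys)"
    using signal_and[OF _ PF(1) up5[OF up4[OF up3[OF up2[OF s0]]]]] k0
    by (simp add: o6_def add.assoc)
  have s6: "signal m (k + 7) out' (k + 6) (\<lambda>ys. \<forall>i<2 * Suc j. ys ! i)"
    using signal_and[OF _ s5 up6[OF up5[OF up4[OF up3[OF s1]]]]] k0 unfolding PF(2) all_less_double[symmetric]
    by (simp add: out' add.assoc)
  have v1: "valid_out m (k + 1) o1"
    using valid_out_input[OF valid, of "2 * int j"] j by (simp add: o1_def)
  have v2: "valid_out m (k + 2) o2"
    using valid_out_input[OF v1, of "2 * int j + 1"] j by (simp add: o2_def add.assoc)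
  have v3: "valid_out m (k + 3) o3"
    using valid_out_binary[OF v2 up2[OF s0] s1, of 3] by (simp add: o3_def add.assoc)
  have v4: "valid_out m (k + 4) o4"
    using valid_out_binary[OF v3 PA(1) s2, of 2] by (simp add: o4_def add.assoc)
  have v5: "valid_out m (k + 5) o5"
    using valid_out_binary[OF v4 PT(1) up4[OF s2], of 3] by (simp add: o5_def add.assoc)
  have v6: "valid_out m (k + 6) o6"
    using valid_out_binary[OF v5 PF(1) up5[OF up4[OF up3[OF up2[OF s0]]]], of 2]
    by (simp add: o6_def add.assoc)
  have v7: "valid_out m (k + 7) out'"
    using valid_out_binary[OF v6 s5 up6[OF up5[OF up4[OF up3[OF s1]]]], of 2]
    by (simp add: out' add.assoc)
  show "prefix_ok m (Suc j) (7 + k) out' (3 + k) (4 + k) (6 + k)"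
    using v7 k up7[OF up6[OF up5[OF s3]]] up7[OF up6[OF s4]] s6
    unfolding prefix_ok_def add.commute[of _ k] by simp
  show "signal m (7 + k) out' k ?y" "signal m (7 + k) out' (1 + k) ?z"
    unfolding add.commute[of _ k] using up s0 s1 by blast+
  show "signal m k out x P \<Longrightarrow> signal m (7 + k) out' x P"
    unfolding add.commute[of _ k] using up by blast
qed

section \<open>Correctness of the program\<close>

text \<open>The two counts and the variables fill \<open>length vs + 2\<close> cells, which is
  therefore the address of the first clause.\<close>

definition input_array :: "nat list \<Rightarrow> int list list \<Rightarrow> int \<Rightarrow> int" where
  "input_array vs cs x =
     (let xs = [int (length vs)] @ map (\<lambda>v. int v + 1) vs @ [int (length cs)] @ code_stream cs
      in if 0 \<le> x \<and> x < int (length xs) then xs ! nat x else 0)"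

lemma input_array_simps [simp]:
  "input_array vs cs 0 = int (length vs)"
  "j < length vs \<Longrightarrow> input_array vs cs (int j + 1) = int (vs ! j) + 1"
  "input_array vs cs (int (length vs) + 1) = int (length cs)"
  "m < length (code_stream cs) \<Longrightarrow> input_array vs cs (int (length vs) + 2 + int m) = code_stream cs ! m"
  by (auto simp: input_array_def nth_append nat_add_distrib)

text \<open>An unset entry of \<open>cur\<close> points to gate \<open>T\<close>, which is written
  only in the last block. Until then the first disjunct records that the signal wanted there is
  constantly true.\<close>

definition inputs_read :: "nat list \<Rightarrow> int list list \<Rightarrow> nat \<Rightarrow> state \<Rightarrow> bool" where
  "inputs_read vs cs j s \<longleftrightarrow>
     arr s ''input'' = input_array vs cs \<and> arr s ''mark'' = (\<lambda>_. 0) \<and> arr s ''D'' = (\<lambda>_. 0) \<and>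
     scalar s ''n'' = int (length vs) \<and> scalar s ''T'' = 7 * int (length vs) - 3 \<and>
     scalar s ''j'' = int j \<and>
     prefix_ok (2 * length vs) j (scalar s ''k'') (arr s ''output'')
       (scalar s ''acc'') (scalar s ''tt'') (scalar s ''ff'') \<and>
     (\<forall>x. arr s ''cur'' x = 0 \<and> (\<forall>ys. initial vs j ys x) \<or>
        signal (2 * length vs) (scalar s ''k'') (arr s ''output'')
          (scalar s ''T'' + arr s ''cur'' x) (\<lambda>ys. initial vs j ys x))"

lemma initial_Suc_neq:
  "x \<noteq> int (vs ! j) + 1 \<Longrightarrow> x \<noteq> - int (vs ! j) - 1 \<Longrightarrow> initial vs (Suc j) ys x = initial vs j ys x"
  by (auto simp: initial_def less_Suc_eq)

text \<open>Distinctness makes block \<open>j\<close> the only one that touches these two literals,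
  so their signals are bare inputs.\<close>

lemma initial_Suc_eq:
  assumes "distinct vs" "j < length vs"
  shows "initial vs (Suc j) ys (int (vs ! j) + 1) = ys ! (2 * j)"
    and "initial vs (Suc j) ys (- int (vs ! j) - 1) = ys ! Suc (2 * j)"
  using assms by (auto simp: initial_def less_Suc_eq nth_eq_iff_index_eq)

lemma inputs_read_step:
  assumes dist: "distinct vs" and j: "j < length vs" and I: "inputs_read vs cs j s"
  shows "bval (Less (Var ''j'') (Var ''n'')) s \<and>
    wp read_input s (\<lambda>t s'. t \<le> 1000 \<and> inputs_read vs cs (Suc j) s')"
proof -
  let ?m = "2 * length vs"
  have ok: "prefix_ok ?m j (scalar s ''k'') (arr s ''output'')
      (scalar s ''acc'') (scalar s ''tt'') (scalar s ''ff'')"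
    and cur: "arr s ''cur'' x = 0 \<and> (\<forall>ys. initial vs j ys x) \<or>
        signal ?m (scalar s ''k'') (arr s ''output'')
          (scalar s ''T'' + arr s ''cur'' x) (\<lambda>ys. initial vs j ys x)" for x
    using I unfolding inputs_read_def by blast+
  have "Suc (2 * j) < ?m" using j by simp
  note step = prefix_ok_step[OF ok this]
  show ?thesis
    using I j step(1-3) cur step(4)
    by (auto simp: read_input_def inputs_read_def input_gates_def[symmetric]
        initial_Suc_eq[OF dist j] initial_Suc_neq)
qed

lemma build_inputs_correct:
  assumes "distinct vs" "inputs_read vs cs 0 s"
  shows "wp build_inputs s (\<lambda>t s'. t \<le> length vs * 1004 + 4 \<and> inputs_read vs cs (length vs) s')"
  unfolding build_inputs_def
  by (rule wp_for[where I = "inputs_read vs cs" and c = 1000])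
    (use assms inputs_read_step in \<open>auto simp: inputs_read_def\<close>)

text \<open>With \<open>N\<close> as a parameter one invariant covers all stages of the propagation.
  \<open>D\<close> needs its own clause: the signals are specified on mixed vectors, and the vector
  of ones is not mixed.\<close>

definition propagated ::
  "nat list \<Rightarrow> int list list \<Rightarrow> (bool list \<Rightarrow> int \<Rightarrow> bool) \<Rightarrow> state \<Rightarrow> bool" where
  "propagated vs cs N s \<longleftrightarrow>
     arr s ''input'' = input_array vs cs \<and>
     scalar s ''n'' = int (length vs) \<and> scalar s ''T'' = 7 * int (length vs) - 3 \<and>
     valid_out (2 * length vs) (scalar s ''k'') (arr s ''output'') \<and>
     signal (2 * length vs) (scalar s ''k'') (arr s ''output'')
       (7 * int (length vs) - 1) (\<lambda>_. False) \<and>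
     signal (2 * length vs) (scalar s ''k'') (arr s ''output'')
       (7 * int (length vs) - 4) (\<lambda>ys. \<forall>i<length vs. ys ! (2 * i) \<or> ys ! (2 * i + 1)) \<and>
     (\<forall>x. signal (2 * length vs) (scalar s ''k'') (arr s ''output'')
       (7 * int (length vs) - 3 + arr s ''cur'' x) (\<lambda>ys. N ys x)) \<and>
     (\<forall>x. arr s ''D'' x = of_bool (\<not> N (replicate (2 * length vs) True) x))"

lemma initial_ones: "initial vs (length vs) (replicate (2 * length vs) True) x"
  by (auto simp: initial_def)

lemma mixed_nth: "mixed m ys \<Longrightarrow> (\<exists>i<m. ys ! i) \<and> \<not> (\<forall>i<m. ys ! i)"
  unfolding mixed_def by (metis in_set_conv_nth)

lemma inputs_read_imp_propagated:
  assumes "inputs_read vs cs (length vs) s"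
  shows "propagated vs cs (\<lambda>ys. initial vs (length vs) ys) s"
proof (cases "vs = []")
  case True
  then show ?thesis
    using assms by (simp add: inputs_read_def propagated_def prefix_ok_def signal_def valid_out_def initial_def)
next
  case False
  let ?sig = "signal (2 * length vs) (scalar s ''k'') (arr s ''output'')"
  have I: "arr s ''input'' = input_array vs cs" "arr s ''D'' = (\<lambda>_. 0)"
      "scalar s ''n'' = int (length vs)" "scalar s ''T'' = 7 * int (length vs) - 3"
      "valid_out (2 * length vs) (scalar s ''k'') (arr s ''output'')"
      "?sig (7 * int (length vs) - 4) (\<lambda>ys. \<forall>i<length vs. ys ! (2 * i) \<or> ys ! (2 * i + 1))"
      "?sig (7 * int (length vs) - 3) (\<lambda>ys. \<exists>i<2 * length vs. ys ! i)"
      "?sig (7 * int (length vs) - 1) (\<lambda>ys. \<forall>i<2 * length vs. ys ! i)"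
    using assms False by (auto simp: inputs_read_def prefix_ok_def)
  have cur: "arr s ''cur'' x = 0 \<and> (\<forall>ys. initial vs (length vs) ys x) \<or>
        ?sig (scalar s ''T'' + arr s ''cur'' x) (\<lambda>ys. initial vs (length vs) ys x)" for x
    using assms unfolding inputs_read_def by blast
  \<comment> \<open>On a mixed vector some input is true and some is false; here and below this
    turns the two accumulated gates into constants.\<close>
  have tt: "?sig (7 * int (length vs) - 3) (\<lambda>_. True)"
    using I(7) by (rule signal_cong) (use mixed_nth in blast)
  have "?sig (7 * int (length vs) - 3 + arr s ''cur'' x) (\<lambda>ys. initial vs (length vs) ys x)" for x
    using cur[of x] tt I(4) by auto
  moreover have "?sig (7 * int (length vs) - 1) (\<lambda>_. False)"
    using I(8) by (rule signal_cong) (use mixed_nth in blast)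
  ultimately show ?thesis
    using I by (simp add: propagated_def initial_ones)
qed

section \<open>Length of the clause stream and number of rounds\<close>

definition scanned ::
  "nat list \<Rightarrow> int list list \<Rightarrow> (bool list \<Rightarrow> int \<Rightarrow> bool) \<Rightarrow> nat \<Rightarrow> state \<Rightarrow> bool" where
  "scanned vs cs N m s \<longleftrightarrow> propagated vs cs N s \<and>
     scalar s ''p'' = int (length vs) + 2 + int m \<and>
     scalar s ''c'' = int (length (filter (\<lambda>x. x = 0) (drop m (code_stream cs)))) \<and>
     (\<forall>x. arr s ''mark'' x = of_bool (x \<in> set (take m (code_stream cs)) - {0})) \<and>
     scalar s ''R'' = 1 + int (card (set (take m (code_stream cs)) - {0}))"

text \<open>A nonempty stream ends with a terminator, so every nonempty suffix contains one.
  Counting terminators down thus stops the scan exactly at the end of the stream.\<close>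

lemma zeros_left:
  assumes "m < length (code_stream cs)"
  shows "0 < length (filter (\<lambda>x. x = 0) (drop m (code_stream cs)))"
proof -
  have "cs \<noteq> []" using assms by (auto simp: code_stream_def)
  then have "last (code_stream cs) = 0"
    by (cases cs rule: rev_cases) (simp_all add: code_stream_def)
  then have "0 \<in> set (drop m (code_stream cs))"
    using assms by (metis drop_eq_Nil last_drop last_in_set not_le)
  then show ?thesis by (auto simp: filter_empty_conv)
qed

lemma scan_clauses_correct:
  assumes "scanned vs cs N 0 s"
  shows "wp scan_clauses s
    (\<lambda>t s'. t \<le> length (code_stream cs) * 104 + 4 \<and> scanned vs cs N (length (code_stream cs)) s')"
proof -
  let ?b = "Less (Num 0) (Var ''c'')" and ?M = "length (code_stream cs)"
  show ?thesis
    unfolding scan_clauses_def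
  proof (rule wp_for[where I = "scanned vs cs N" and c = 100])
    fix m s
    assume m: "m < ?M" and I: "scanned vs cs N m s"
    let ?x = "code_stream cs ! m"
    have drop: "drop m (code_stream cs) = ?x # drop (Suc m) (code_stream cs)"
      and take: "set (take (Suc m) (code_stream cs)) = insert ?x (set (take m (code_stream cs)))"
      using m by (simp_all add: Cons_nth_drop_Suc take_Suc_conv_app_nth)
    have card: "card (insert ?x (set (take m (code_stream cs))) - {0}) =
        (if ?x = 0 \<or> ?x \<in> set (take m (code_stream cs)) then 0 else 1)
          + card (set (take m (code_stream cs)) - {0})"
      by (simp add: insert_Diff_if insert_absorb)
    show "bval ?b s \<and> wp (Cond (Equal (Get ''input'' (Var ''p'')) (Num 0))
          (Assign ''c'' (Minus (Var ''c'') (Num 1)))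
          (Cond (Equal (Get ''mark'' (Get ''input'' (Var ''p''))) (Num 0))
             (Store ''mark'' (Get ''input'' (Var ''p'')) (Num 1) ;;
              Assign ''R'' (Plus (Var ''R'') (Num 1)))
             Skip) ;;
        Assign ''p'' (Plus (Var ''p'') (Num 1))) s
       (\<lambda>t s'. t \<le> 100 \<and> scanned vs cs N (Suc m) s')"
      using I m zeros_left[OF m]
      by (auto simp: scanned_def propagated_def take card drop)
  qed (use assms in \<open>auto simp: scanned_def\<close>)
qed

section \<open>Updating the signal of a single stream position\<close>

definition joined ::
  "nat list \<Rightarrow> int list list \<Rightarrow> (bool list \<Rightarrow> int \<Rightarrow> bool) \<Rightarrow> int list \<Rightarrow> nat \<Rightarrow> int \<Rightarrow> nat \<Rightarrow> state \<Rightarrow> bool" where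
  "joined vs cs N c i base l s \<longleftrightarrow> propagated vs cs N s \<and>
     scalar s ''p'' = base + int i \<and> scalar s ''q'' = base + int l \<and>
     signal (2 * length vs) (scalar s ''k'') (arr s ''output'') (scalar s ''g'')
       (\<lambda>ys. others_alive c i l (N ys)) \<and>
     scalar s ''h'' =
       of_bool (\<not> others_alive c i l (N (replicate (2 * length vs) True)))"

lemma propagated_binary:
  assumes "propagated vs cs N s"
    and "signal (2 * length vs) (scalar s ''k'') (arr s ''output'') a P"
    and "signal (2 * length vs) (scalar s ''k'') (arr s ''output'') b P'"
    and "opc \<in> {2, 3}"
    and "arr s' = (arr s)(''output'' := put_gate opc a b (scalar s ''k'') (arr s ''output''))"
    and "scalar s' ''n'' = scalar s ''n''" "scalar s' ''T'' = scalar s ''T''"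
    and "scalar s' ''k'' = scalar s ''k'' + 1"
  shows "propagated vs cs N s'"
  using assms signal_put valid_out_binary unfolding propagated_def by (auto split: if_splits)

text \<open>\<open>X\<close> is a frame: the loop writes only the four excluded registers.\<close>

lemma join_others_correct:
  assumes I: "joined vs cs N c i base 0 s" and c: "0 \<notin> set c"
    and read: "\<And>j. j \<le> length c \<Longrightarrow> input_array vs cs (base + int j) = (c @ [0]) ! j"
    and frame: "\<forall>x\<in>X. x \<notin> {''g'', ''h'', ''q'', ''k''}"
  shows "wp join_others s (\<lambda>t s'. t \<le> length c * 106 + 6 \<and>
    joined vs cs N c i base (length c) s' \<and> (\<forall>x\<in>X. scalar s' x = scalar s x))"
proof -
  let ?b = "Neg_b (Equal (Get ''input'' (Var ''q'')) (Num 0))" and ?m = "2 * length vs"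
  let ?I = "\<lambda>l s'. joined vs cs N c i base l s' \<and> (\<forall>x\<in>X. scalar s' x = scalar s x)"
  show ?thesis
    unfolding join_others_def
  proof (rule wp_for[where I = ?I and c = 100])
    fix l s1
    assume l: "l < length c" and I: "?I l s1"
    have x: "input_array vs cs (base + int l) = c ! l" "c ! l \<noteq> 0"
      using read[of l] l c by (auto simp: nth_append in_set_conv_nth)
    have g: "signal ?m (scalar s1 ''k'') (arr s1 ''output'') (scalar s1 ''g'')
         (\<lambda>ys. others_alive c i l (N ys))"
       and z: "signal ?m (scalar s1 ''k'') (arr s1 ''output'')
         (7 * int (length vs) - 3 + arr s1 ''cur'' (- (c ! l))) (\<lambda>ys. N ys (- (c ! l)))"
       and k: "0 \<le> scalar s1 ''k''"
      using I by (auto simp: joined_def propagated_def valid_out_def)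
    note or = signal_or[OF k g z]
    have P: "propagated vs cs N s1" using I by (simp add: joined_def)
    note P' = propagated_binary[OF P g z, of 3]
    show "bval ?b s1 \<and> wp
       (Cond (Equal (Var ''q'') (Var ''p''))
          Skip
          (push 3 (Var ''g'') (Plus (Var ''T'') (Get ''cur'' (neg (Get ''input'' (Var ''q''))))) ;;
           Assign ''g'' (Minus (Var ''k'') (Num 1)) ;;
           Cond (Equal (Get ''D'' (neg (Get ''input'' (Var ''q'')))) (Num 0))
             (Assign ''h'' (Num 0))
             Skip) ;;
        Assign ''q'' (Plus (Var ''q'') (Num 1))) s1 (\<lambda>t s'. t \<le> 100 \<and> ?I (Suc l) s')"
    proof (cases "l = i")
      case True
      then show ?thesis
        using I x frame by (auto simp: joined_def propagated_def)
    next
      case False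
      have D: "arr s1 ''D'' (- (c ! l)) = of_bool (\<not> N (replicate ?m True) (- (c ! l)))"
         "arr s1 ''input'' = input_array vs cs" "scalar s1 ''T'' = 7 * int (length vs) - 3"
        using P by (simp_all add: propagated_def)
      have J: "scalar s1 ''p'' = base + int i" "scalar s1 ''q'' = base + int l"
          "scalar s1 ''h'' =
             of_bool (\<not> others_alive c i l (N (replicate ?m True)))"
          "\<forall>x\<in>X. scalar s1 x = scalar s x"
        using I by (simp_all add: joined_def)
      show ?thesis
        using False or x D J frame
        by (auto simp: joined_def intro!: P')
    qed
  qed (use I c read[of "length c"] in \<open>auto simp: joined_def propagated_def\<close>)
qed

lemma process_position_correct:
  assumes P: "propagated vs cs N s" and c: "0 \<notin> set c" and i: "i \<le> length c"
    and read: "\<And>j. j \<le> length c \<Longrightarrow> input_array vs cs (base + int j) = (c @ [0]) ! j"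
    and p: "scalar s ''p'' = base + int i" and b: "scalar s ''b'' = base"
  shows "wp process_position s (\<lambda>t s'. t \<le> length c * 106 + 200 \<and>
    propagated vs cs (\<lambda>ys. update (c, i) (N ys)) s' \<and> scalar s' ''p'' = base + int i + 1 \<and>
    scalar s' ''b'' = (if i < length c then base else base + int i + 1) \<and>
    (\<forall>x\<in>{''r'', ''R'', ''E''}. scalar s' x = scalar s x))"
proof -
  let ?m = "2 * length vs" and ?x = "(c @ [0]) ! i" and ?ones = "replicate (2 * length vs) True"
  let ?X = "{''p'', ''b'', ''r'', ''R'', ''E''}"
  have x: "input_array vs cs (base + int i) = ?x" "?x = 0 \<longleftrightarrow> \<not> i < length c"
    using read[OF i] i c by (auto simp: nth_append in_set_conv_nth)
  \<comment> \<open>Gate \<open>T + 2\<close> is false, the empty disjunction; correspondingly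
    \<open>h = 1\<close> says that no other literal has been found alive.\<close>
  let ?s1 = "s\<lparr>scalar := (scalar s)(''g'' := scalar s ''T'' + 2, ''h'' := 1, ''q'' := scalar s ''b'')\<rparr>"
  have "joined vs cs N c i base 0 ?s1"
    using P p b by (auto simp: joined_def propagated_def)
  from join_others_correct[OF this c read, of ?X]
  have "wp join_others ?s1 (\<lambda>t s'. t \<le> length c * 106 + 6 \<and>
      joined vs cs N c i base (length c) s' \<and> (\<forall>x\<in>?X. scalar s' x = scalar ?s1 x))"
    by simp
  \<comment> \<open>The summand 8 is the cost of the three assignments that lead to
    \<open>?s1\<close>.\<close>
  then have "wp join_others ?s1 (\<lambda>t1 s'.
      wp (push 2 (Plus (Var ''T'') (Get ''cur'' (Get ''input'' (Var ''p'')))) (Var ''g'') ;;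
     Store ''cur'' (Get ''input'' (Var ''p'')) (Minus (Minus (Var ''k'') (Num 1)) (Var ''T'')) ;;
     Cond (Equal (Var ''h'') (Num 1)) (Store ''D'' (Get ''input'' (Var ''p'')) (Num 1)) Skip ;;
     Cond (Equal (Get ''input'' (Var ''p'')) (Num 0))
       (Assign ''b'' (Plus (Var ''p'') (Num 1))) Skip ;;
     Assign ''p'' (Plus (Var ''p'') (Num 1))) s' (\<lambda>t2 s'. t1 + t2 + 8 \<le> length c * 106 + 200 \<and>
    propagated vs cs (\<lambda>ys. update (c, i) (N ys)) s' \<and> scalar s' ''p'' = base + int i + 1 \<and>
    scalar s' ''b'' = (if i < length c then base else base + int i + 1) \<and>
    (\<forall>x\<in>{''r'', ''R'', ''E''}. scalar s' x = scalar s x)))"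
  proof (rule wp_mono)
    fix t1 s'
    assume "t1 \<le> length c * 106 + 6 \<and> joined vs cs N c i base (length c) s' \<and>
      (\<forall>x\<in>?X. scalar s' x = scalar ?s1 x)"
    then have t1: "t1 \<le> length c * 106 + 6" and J: "joined vs cs N c i base (length c) s'"
      and X: "\<forall>x\<in>?X. scalar s' x = scalar ?s1 x"
      by blast+
    let ?k = "scalar s' ''k''" and ?out = "arr s' ''output''"
    have g: "signal ?m ?k ?out (scalar s' ''g'') (\<lambda>ys. others_alive c i (length c) (N ys))"
      and z: "signal ?m ?k ?out (7 * int (length vs) - 3 + arr s' ''cur'' y) (\<lambda>ys. N ys y)"
      and k: "0 \<le> ?k" and valid: "valid_out ?m ?k ?out" for y
      using J by (auto simp: joined_def propagated_def valid_out_def)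
    note new = signal_and[OF k z[of ?x] g] valid_out_binary[OF valid z[of ?x] g, of 2]
      signal_put[of ?m ?k ?out _ _ 2 "7 * int (length vs) - 3 + arr s' ''cur'' ?x" "scalar s' ''g''"]
    show "wp (push 2 (Plus (Var ''T'') (Get ''cur'' (Get ''input'' (Var ''p'')))) (Var ''g'') ;;
     Store ''cur'' (Get ''input'' (Var ''p'')) (Minus (Minus (Var ''k'') (Num 1)) (Var ''T'')) ;;
     Cond (Equal (Var ''h'') (Num 1)) (Store ''D'' (Get ''input'' (Var ''p'')) (Num 1)) Skip ;;
     Cond (Equal (Get ''input'' (Var ''p'')) (Num 0))
       (Assign ''b'' (Plus (Var ''p'') (Num 1))) Skip ;;
     Assign ''p'' (Plus (Var ''p'') (Num 1))) s' (\<lambda>t2 s'. t1 + t2 + 8 \<le> length c * 106 + 200 \<and>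
    propagated vs cs (\<lambda>ys. update (c, i) (N ys)) s' \<and> scalar s' ''p'' = base + int i + 1 \<and>
    scalar s' ''b'' = (if i < length c then base else base + int i + 1) \<and>
    (\<forall>x\<in>{''r'', ''R'', ''E''}. scalar s' x = scalar s x))"
      using t1 J X x new p b by (auto simp: joined_def propagated_def)
  qed
  then show ?thesis
    by (simp add: process_position_def eval_nat_numeral)
qed

section \<open>Sweeps over the stream and their repetition\<close>

definition sweeping ::
  "nat list \<Rightarrow> int list list \<Rightarrow> (bool list \<Rightarrow> int \<Rightarrow> bool) \<Rightarrow> int \<Rightarrow> int \<Rightarrow> nat \<Rightarrow> state \<Rightarrow> bool" where
  "sweeping vs cs N r R m s \<longleftrightarrow>
     propagated vs cs (\<lambda>ys. fold update (take m (positions cs)) (N ys)) s \<and>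
     scalar s ''p'' = int (length vs) + 2 + int m \<and> scalar s ''r'' = r \<and> scalar s ''R'' = R \<and>
     scalar s ''E'' = int (length vs) + 2 + int (length (code_stream cs)) \<and>
     (m < length (code_stream cs) \<longrightarrow>
        scalar s ''b'' = int (length vs) + 2 + int m - int (snd (positions cs ! m)))"

lemma sweeping_step:
  assumes I: "sweeping vs cs N r R m s" and m: "m < length (code_stream cs)"
    and cs: "\<forall>c\<in>set cs. 0 \<notin> set c \<and> length c \<le> w"
  shows "wp process_position s (\<lambda>t s'. t \<le> w * 106 + 200 \<and> sweeping vs cs N r R (Suc m) s')"
proof -
  obtain c i where ci: "positions cs ! m = (c, i)" by fastforce
  have m': "m < length (positions cs)" using m by (simp add: length_positions)
  note pos = positions_nth[OF m' ci]
  let ?base = "int (length vs) + 2 + int (m - i)"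
  let ?N = "\<lambda>ys. fold update (take m (positions cs)) (N ys)"
  have read: "input_array vs cs (?base + int j) = (c @ [0]) ! j" if "j \<le> length c" for j
  proof -
    have "m - i + j < length (code_stream cs)" "code_stream cs ! (m - i + j) = (c @ [0]) ! j"
      using pos that by blast+
    then show ?thesis
      using input_array_simps(4)[of "m - i + j" cs vs] by (simp add: add.assoc)
  qed
  have base: "?base + int i = int (length vs) + 2 + int m" using pos by simp
  have "wp process_position s (\<lambda>t s'. t \<le> length c * 106 + 200 \<and>
    propagated vs cs (\<lambda>ys. update (c, i) (?N ys)) s' \<and> scalar s' ''p'' = ?base + int i + 1 \<and>
    scalar s' ''b'' = (if i < length c then ?base else ?base + int i + 1) \<and>
    (\<forall>x\<in>{''r'', ''R'', ''E''}. scalar s' x = scalar s x))"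
    by (rule process_position_correct)
      (use I m cs pos base ci read in \<open>auto simp: sweeping_def\<close>)
  then show ?thesis
  proof (rule wp_mono)
    fix t s'
    assume post: "t \<le> length c * 106 + 200 \<and>
    propagated vs cs (\<lambda>ys. update (c, i) (?N ys)) s' \<and> scalar s' ''p'' = ?base + int i + 1 \<and>
    scalar s' ''b'' = (if i < length c then ?base else ?base + int i + 1) \<and>
    (\<forall>x\<in>{''r'', ''R'', ''E''}. scalar s' x = scalar s x)"
    have "length c \<le> w" using pos cs by blast
    then have "t \<le> w * 106 + 200" using post by linarith
    moreover have "scalar s' ''b'' = int (length vs) + 2 + int (Suc m) - int (snd (positions cs ! Suc m))"
      if "Suc m < length (code_stream cs)"
    proof -
      \<comment> \<open>Inside a clause its start stays in \<open>b\<close>; a terminator is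
        followed by the start of a clause, and \<open>b\<close> moves there.\<close>
      have "if i < length c then positions cs ! Suc m = (c, Suc i) else snd (positions cs ! Suc m) = 0"
        using that ci by (intro positions_next) (simp_all add: length_positions)
      then show ?thesis
        using post base by (auto split: if_splits)
    qed
    ultimately show "t \<le> w * 106 + 200 \<and> sweeping vs cs N r R (Suc m) s'"
      using post I base by (simp add: sweeping_def fold_take_Suc[OF m'] ci)
  qed
qed

lemma sweep_loop_correct:
  assumes I: "sweeping vs cs N r R 0 s" and cs: "\<forall>c\<in>set cs. 0 \<notin> set c \<and> length c \<le> w"
  shows "wp (While (Less (Var ''p'') (Var ''E'')) process_position) s
    (\<lambda>t s'. t \<le> length (code_stream cs) * (w * 106 + 204) + 4 \<and>
       sweeping vs cs N r R (length (code_stream cs)) s')"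
proof -
  let ?b = "Less (Var ''p'') (Var ''E'')" and ?M = "length (code_stream cs)"
  show ?thesis
  proof (rule wp_for[where I = "sweeping vs cs N r R" and c = "w * 106 + 200"])
    fix m s
    assume "m < ?M" "sweeping vs cs N r R m s"
    then show "bval ?b s \<and> wp process_position s
        (\<lambda>t s'. t \<le> w * 106 + 200 \<and> sweeping vs cs N r R (Suc m) s')"
      using sweeping_step[of vs cs N r R m s w] cs by (auto simp: sweeping_def)
  qed (use I in \<open>auto simp: sweeping_def\<close>)
qed

definition swept ::
  "nat list \<Rightarrow> int list list \<Rightarrow> (bool list \<Rightarrow> int \<Rightarrow> bool) \<Rightarrow> nat \<Rightarrow> nat \<Rightarrow> state \<Rightarrow> bool" where
  "swept vs cs N R r s \<longleftrightarrow>
     propagated vs cs (\<lambda>ys. (sweep cs ^^ r) (N ys)) s \<and>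
     scalar s ''r'' = int r \<and> scalar s ''R'' = int R \<and>
     scalar s ''E'' = int (length vs) + 2 + int (length (code_stream cs))"

lemma propagate_correct:
  assumes I: "swept vs cs N R 0 s" and cs: "\<forall>c\<in>set cs. 0 \<notin> set c \<and> length c \<le> w"
  shows "wp propagate s
    (\<lambda>t s'. t \<le> R * (length (code_stream cs) * (w * 106 + 204) + 24) + 4 \<and> swept vs cs N R R s')"
proof -
  let ?b = "Less (Var ''r'') (Var ''R'')" and ?M = "length (code_stream cs)"
  show ?thesis
    unfolding propagate_def
  proof (rule wp_for[where I = "swept vs cs N R" and c = "?M * (w * 106 + 204) + 20"])
    fix r s
    assume r: "r < R" and I: "swept vs cs N R r s"
    let ?s1 = "s\<lparr>scalar := (scalar s)(''p'' := scalar s ''n'' + 2, ''b'' := scalar s ''n'' + 2)\<rparr>"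
    have "sweeping vs cs (\<lambda>ys. (sweep cs ^^ r) (N ys)) (int r) (int R) 0 ?s1"
      using I positions_start[of cs]
      by (auto simp: swept_def sweeping_def propagated_def length_positions)
    note loop = sweep_loop_correct[OF this cs]
    show "bval ?b s \<and> wp (Assign ''p'' (Plus (Var ''n'') (Num 2)) ;;
        Assign ''b'' (Var ''p'') ;;
        While (Less (Var ''p'') (Var ''E'')) process_position ;;
        Assign ''r'' (Plus (Var ''r'') (Num 1))) s
        (\<lambda>t s'. t \<le> ?M * (w * 106 + 204) + 20 \<and> swept vs cs N R (Suc r) s')"
      using I r
      by (auto simp: swept_def intro!: wp_mono[OF loop])
        (auto simp: sweeping_def swept_def propagated_def sweep_def length_positions)
  qed (use I in \<open>auto simp: swept_def\<close>)
qed

section \<open>From the output array to an encoded circuit\<close>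

lemma length_enc_gate [simp]: "length (enc_gate g) = 3"
  by (cases g) simp_all

lemma length_enc_gates [simp]: "length (concat (map enc_gate Q)) = 3 * length Q"
  by (induction Q) simp_all

lemma enc_gates_nth:
  "l < 3 * length Q \<Longrightarrow> concat (map enc_gate Q) ! l = enc_gate (Q ! (l div 3)) ! (l mod 3)"
proof (induction Q arbitrary: l)
  case (Cons g Q)
  show ?case
  proof (cases "l < 3")
    case False
    then have "l = 3 + (l - 3)" by simp
    then obtain l' where l': "l = 3 + l'" by blast
    then have "l div 3 = Suc (l' div 3)" "l mod 3 = l' mod 3" by presburger+
    then show ?thesis using Cons l' by (simp add: nth_append)
  qed (simp add: nth_append)
qed simp

lemma has_output_circuit:
  assumes "arr s ''output'' 0 = int (length Q)"
    and "\<And>i. i < length Q \<Longrightarrow> enc_gate (Q ! i) =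
      [arr s ''output'' (3 * int i + 1), arr s ''output'' (3 * int i + 2), arr s ''output'' (3 * int i + 3)]"
  shows "has_output s (enc_circuit Q)"
  unfolding has_output_def
proof (intro allI impI)
  fix l
  assume l: "l < length (enc_circuit Q)"
  show "arr s ''output'' (int l) = enc_circuit Q ! l"
  proof (cases l)
    case 0
    then show ?thesis using assms(1) by (simp add: enc_circuit_def)
  next
    case (Suc l')
    define i r where "i = l' div 3" and "r = l' mod 3"
    have l': "l' = 3 * i + r" "r < 3" by (simp_all add: i_def r_def)
    have "i < length Q" using l Suc by (simp add: enc_circuit_def i_def less_mult_imp_div_less mult.commute)
    from assms(2)[OF this] have "enc_gate (Q ! i) ! r = arr s ''output'' (int l)"
      using l' Suc by (auto simp: less_Suc_eq numeral_3_eq_3 add.commute)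
    moreover have "enc_circuit Q ! l = enc_gate (Q ! i) ! r"
      using l Suc by (simp add: enc_circuit_def enc_gates_nth i_def r_def)
    ultimately show ?thesis by simp
  qed
qed

lemma finish_correct:
  assumes P: "propagated vs cs N s"
  shows "wp finish s (\<lambda>t s'. t \<le> 100 \<and> (\<exists>Q. has_output s' (enc_circuit Q) \<and>
    (if vs \<noteq> [] \<and> N (replicate (2 * length vs) True) 0
     then wf_circuit (2 * length vs) Q \<and> (\<forall>b. ConstG b \<notin> set Q) \<and>
       (\<forall>ys. mixed (2 * length vs) ys \<longrightarrow>
          circuit_val Q ys = (N ys 0 \<and> (\<forall>i<length vs. ys ! (2 * i) \<or> ys ! (2 * i + 1))))
     else Q = [ConstG (N (replicate (2 * length vs) True) 0)])))"
proof (cases "vs \<noteq> [] \<and> N (replicate (2 * length vs) True) 0")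
  case False
  then have D: "\<not> (0 < scalar s ''n'' \<and> arr s ''D'' 0 = 0)"
      "arr s ''D'' 0 = of_bool (\<not> N (replicate (2 * length vs) True) 0)"
    using P by (auto simp: propagated_def)
  show ?thesis
    unfolding if_not_P[OF False] using D
    by (auto simp: finish_def has_output_def enc_circuit_def less_Suc_eq put_gate_def numeral_eq_Suc)
next
  case True
  let ?m = "2 * length vs" and ?k = "scalar s ''k''" and ?a = "7 * int (length vs) - 3 + arr s ''cur'' 0"
    and ?b = "7 * int (length vs) - 4"
  let ?out = "put_gate 2 ?a ?b ?k (arr s ''output'')"
  have m: "0 < ?m" using True by simp
  have a: "signal ?m ?k (arr s ''output'') ?a (\<lambda>ys. N ys 0)"
    and b: "signal ?m ?k (arr s ''output'') ?b (\<lambda>ys. \<forall>i<length vs. ys ! (2 * i) \<or> ys ! (2 * i + 1))"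
    and valid: "valid_out ?m ?k (arr s ''output'')" and k: "0 \<le> ?k"
    using P by (auto simp: propagated_def valid_out_def)
  have sig: "signal ?m (?k + 1) ?out ?k
      (\<lambda>ys. N ys 0 \<and> (\<forall>i<length vs. ys ! (2 * i) \<or> ys ! (2 * i + 1)))"
    using signal_and[OF k a b] .
  have valid': "valid_out ?m (?k + 1) ?out"
    using valid_out_binary[OF valid a b] by simp
  let ?Q = "circuit_at (?k + 1) ?out"
  have len: "length ?Q = Suc (nat ?k)" using k by simp
  have wf: "wf_circuit ?m ?Q"
    unfolding wf_circuit_def
  proof (intro conjI allI impI)
    show "?Q \<noteq> []" using len by (metis list.size(3) nat.distinct(1))
    show "wf_gate ?m i (?Q ! i)" if "i < length ?Q" for i
      using valid' m that unfolding valid_out_def length_circuit_at by blast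
  qed
  have noconst: "ConstG b \<notin> set ?Q" for b
    by (auto simp: circuit_at_def dec_gate_def)
  have val: "circuit_val ?Q ys = (N ys 0 \<and> (\<forall>i<length vs. ys ! (2 * i) \<or> ys ! (2 * i + 1)))"
    if "mixed ?m ys" for ys
  proof -
    have "gate_vals ys ?Q \<noteq> []" using len by (metis length_gate_vals list.size(3) nat.distinct(1))
    then have "circuit_val ?Q ys = gate_vals ys ?Q ! nat ?k"
      using len by (simp add: circuit_val_def last_conv_nth)
    then show ?thesis using sig m that by (auto simp: signal_def)
  qed
  have "has_output s' (enc_circuit ?Q)" if "arr s' ''output'' = ?out(0 := ?k + 1)" for s'
    using that valid' m k len by (intro has_output_circuit) (auto simp: valid_out_def)
  moreover have "arr s ''D'' 0 = 0" "0 < scalar s ''n''" "scalar s ''T'' = 7 * int (length vs) - 3"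
    using P True by (auto simp: propagated_def)
  ultimately show ?thesis
    unfolding if_P[OF True] using wf noconst val
    by (auto simp: finish_def intro!: exI[of _ ?Q])
qed

text \<open>Composed from the end: each intermediate fact bounds all remaining phases at once, so
  only the leading loop has to be opened. The growing constants 104, 120, 150 and 200 absorb the
  assignments in between.\<close>

lemma circuit_program_correct:
  fixes vs :: "nat list" and cs :: "int list list"
  defines "M \<equiv> length (code_stream cs)" and "R \<equiv> Suc (card (set (code_stream cs) - {0}))"
  defines "N \<equiv> \<lambda>ys. (sweep cs ^^ R) (initial vs (length vs) ys)"
  assumes dist: "distinct vs" and cs: "\<forall>c\<in>set cs. 0 \<notin> set c \<and> length c \<le> w"
  shows "\<exists>t s Q. exec circuit_program
      (init_state ([int (length vs)] @ map (\<lambda>v. int v + 1) vs @ [int (length cs)] @ code_stream cs)) t s \<and>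
    t \<le> length vs * 1004 + M * 104 + R * (M * (w * 106 + 204) + 24) + 200 \<and>
    has_output s (enc_circuit Q) \<and>
    (if vs \<noteq> [] \<and> N (replicate (2 * length vs) True) 0
     then wf_circuit (2 * length vs) Q \<and> (\<forall>b. ConstG b \<notin> set Q) \<and>
       (\<forall>ys. mixed (2 * length vs) ys \<longrightarrow>
          circuit_val Q ys = (N ys 0 \<and> (\<forall>i<length vs. ys ! (2 * i) \<or> ys ! (2 * i + 1))))
     else Q = [ConstG (N (replicate (2 * length vs) True) 0)])"
proof -
  let ?s0 = "init_state ([int (length vs)] @ map (\<lambda>v. int v + 1) vs @ [int (length cs)] @ code_stream cs)"
  define post where "post s \<longleftrightarrow> (\<exists>Q. has_output s (enc_circuit Q) \<and>
    (if vs \<noteq> [] \<and> N (replicate (2 * length vs) True) 0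
     then wf_circuit (2 * length vs) Q \<and> (\<forall>b. ConstG b \<notin> set Q) \<and>
       (\<forall>ys. mixed (2 * length vs) ys \<longrightarrow>
          circuit_val Q ys = (N ys 0 \<and> (\<forall>i<length vs. ys ! (2 * i) \<or> ys ! (2 * i + 1))))
     else Q = [ConstG (N (replicate (2 * length vs) True) 0)]))" for s
  define s1 where "s1 = ?s0\<lparr>scalar := (scalar ?s0)(''n'' := int (length vs),
     ''T'' := 7 * int (length vs) - 3, ''acc'' := 2, ''tt'' := 2)\<rparr>"
  have input: "arr ?s0 ''input'' = input_array vs cs"
    by (rule ext) (simp add: init_state_def input_array_def Let_def)
  have init: "inputs_read vs cs 0 s1"
    using input by (simp add: s1_def inputs_read_def prefix_ok_def valid_out_def initial_def)
      (simp add: init_state_def)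
  \<comment> \<open>Since 0 encodes no literal, it occurs once per clause; this is the initial value
    of the counter \<open>c\<close>.\<close>
  have zeros: "length (filter (\<lambda>x. x = 0) (code_stream cs)) = length cs"
    using cs by (induction cs) (auto simp: code_stream_def filter_empty_conv)
  have last: "wp finish s (\<lambda>t s'. t \<le> 100 \<and> post s')"
    if "swept vs cs (\<lambda>ys. initial vs (length vs) ys) R R s" for s
    unfolding post_def N_def
    by (rule finish_correct[where cs = cs]) (use that in \<open>simp add: swept_def\<close>)
  have fin: "wp (propagate ;; finish) s
      (\<lambda>t s'. t \<le> R * (M * (w * 106 + 204) + 24) + 104 \<and> post s')"
    if "swept vs cs (\<lambda>ys. initial vs (length vs) ys) R 0 s" for s
    unfolding wp_Seq M_def
  proof (rule wp_mono[OF propagate_correct[OF that cs]])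
    fix t s'
    assume A: "t \<le> R * (length (code_stream cs) * (w * 106 + 204) + 24) + 4 \<and>
      swept vs cs (\<lambda>ys. initial vs (length vs) ys) R R s'"
    then have "wp finish s' (\<lambda>t s'. t \<le> 100 \<and> post s')" using last by blast
    then show "wp finish s' (\<lambda>t' s''.
        t + t' \<le> R * (length (code_stream cs) * (w * 106 + 204) + 24) + 104 \<and> post s'')"
      by (rule wp_mono) (use A in simp)
  qed
  have scan: "wp (scan_clauses ;; Assign ''E'' (Var ''p'') ;; Assign ''r'' (Num 0) ;; propagate ;; finish) s
      (\<lambda>t s'. t \<le> M * 104 + R * (M * (w * 106 + 204) + 24) + 120 \<and> post s')"
    if "scanned vs cs (\<lambda>ys. initial vs (length vs) ys) 0 s" for s
    unfolding wp_Seq[of scan_clauses]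
  proof (rule wp_mono[OF scan_clauses_correct[OF that]])
    fix t s'
    assume A: "t \<le> length (code_stream cs) * 104 + 4 \<and>
      scanned vs cs (\<lambda>ys. initial vs (length vs) ys) (length (code_stream cs)) s'"
    let ?s = "s'\<lparr>scalar := (scalar s')(''E'' := scalar s' ''p'', ''r'' := 0)\<rparr>"
    have "swept vs cs (\<lambda>ys. initial vs (length vs) ys) R 0 ?s"
      using A by (auto simp: scanned_def swept_def propagated_def R_def)
    from fin[OF this] show "wp (Assign ''E'' (Var ''p'') ;; Assign ''r'' (Num 0) ;; propagate ;; finish) s'
       (\<lambda>t' s''. t + t' \<le> M * 104 + R * (M * (w * 106 + 204) + 24) + 120 \<and> post s'')"
      unfolding wp_Seq[of "Assign _ _"] wp_Assign
      by (simp del: wp_Seq) (erule wp_mono, use A in \<open>simp add: M_def\<close>)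
  qed
  have "wp (build_inputs ;;
     Assign ''c'' (Get ''input'' (Plus (Var ''n'') (Num 1))) ;;
     Assign ''p'' (Plus (Var ''n'') (Num 2)) ;;
     Assign ''R'' (Num 1) ;;
     scan_clauses ;; Assign ''E'' (Var ''p'') ;; Assign ''r'' (Num 0) ;; propagate ;; finish) s1
      (\<lambda>t s'. t \<le> length vs * 1004 + M * 104 + R * (M * (w * 106 + 204) + 24) + 150 \<and> post s')"
    unfolding wp_Seq[of build_inputs]
  proof (rule wp_mono[OF build_inputs_correct[OF dist init]])
    fix t s
    assume A: "t \<le> length vs * 1004 + 4 \<and> inputs_read vs cs (length vs) s"
    then have P: "propagated vs cs (\<lambda>ys. initial vs (length vs) ys) s"
      using inputs_read_imp_propagated by blast
    let ?s = "s\<lparr>scalar := (scalar s)(''c'' := int (length cs), ''p'' := int (length vs) + 2, ''R'' := 1)\<rparr>"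
    have "scanned vs cs (\<lambda>ys. initial vs (length vs) ys) 0 ?s"
      using A P zeros by (auto simp: scanned_def propagated_def inputs_read_def)
    from scan[OF this] show "wp (Assign ''c'' (Get ''input'' (Plus (Var ''n'') (Num 1))) ;;
     Assign ''p'' (Plus (Var ''n'') (Num 2)) ;;
     Assign ''R'' (Num 1) ;;
     scan_clauses ;; Assign ''E'' (Var ''p'') ;; Assign ''r'' (Num 0) ;; propagate ;; finish) s
      (\<lambda>t' s'. t + t' \<le> length vs * 1004 + M * 104 + R * (M * (w * 106 + 204) + 24) + 150 \<and> post s')"
      unfolding wp_Seq[of "Assign _ _"] wp_Assign
      using P by (simp del: wp_Seq add: propagated_def) (erule wp_mono, use A in simp)
  qed
  then have "wp circuit_program ?s0
     (\<lambda>t s'. t \<le> length vs * 1004 + M * 104 + R * (M * (w * 106 + 204) + 24) + 200 \<and> post s')"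
    unfolding circuit_program_def wp_Seq[of "Assign _ _"] wp_Assign
    using input by (simp del: wp_Seq add: s1_def) (erule wp_mono, simp)
  then show ?thesis
    unfolding wp_def post_def by blast
qed

section \<open>Unit-clause propagation and the monotonisation\<close>

lemma update_le: "update p N \<le> N"
  by (cases p) (auto simp: le_fun_def)

lemma fold_update_le: "fold update ps N \<le> N"
proof (induction ps arbitrary: N)
  case (Cons p ps)
  then show ?case using update_le[of p N] by (simp del: update.simps) (rule order.trans)
qed simp

text \<open>Updates only decrease the state, so a later one cannot undo an earlier one: if the whole
  sweep changes nothing, no single update does.\<close>

lemma fold_update_fixed:
  assumes "fold update ps N = N" "p \<in> set ps"
  shows "update p N = N"
  using assms
proof (induction ps)
  case (Cons q ps)
  have "N \<le> update q N"
    using fold_update_le[of ps "update q N"] Cons.prems(1) by simp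
  then have "update q N = N" using update_le[of q N] by (rule antisym[rotated])
  then show ?case using Cons by auto
qed simp

lemma in_positions: "(c, i) \<in> set (positions cs) \<longleftrightarrow> c \<in> set cs \<and> i \<le> length c"
  by (force simp: positions_def less_Suc_eq_le simp del: upt_Suc)

lemma set_code_stream: "insert 0 (set (code_stream cs)) = insert 0 (\<Union>c\<in>set cs. set c)"
  by (auto simp: code_stream_def)

lemma fold_update_support:
  assumes "set ps \<subseteq> set (positions cs)" "x \<notin> insert 0 (set (code_stream cs))"
  shows "fold update ps N x = N x"
  using assms
proof (induction ps arbitrary: N)
  case (Cons p ps)
  obtain c i where p: "p = (c, i)" by fastforce
  have "(c @ [0]) ! i \<in> set (c @ [0])"
    using Cons.prems(1) p by (intro nth_mem) (auto simp: in_positions)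
  then have "(c @ [0]) ! i \<noteq> x"
    using Cons.prems p unfolding set_code_stream by (auto simp: in_positions)
  then have "update p N x = N x" by (simp add: p)
  then show ?case using Cons by simp
qed simp

lemma sweep_fixed_or_progress:
  fixes cs N
  defines "A \<equiv> \<lambda>r. {x \<in> insert 0 (set (code_stream cs)). \<not> (sweep cs ^^ r) N x}"
  shows "sweep cs ((sweep cs ^^ r) N) = (sweep cs ^^ r) N \<or> r \<le> card (A r)"
proof (induction r)
  case (Suc r)
  let ?N = "(sweep cs ^^ r) N"
  show ?case
  proof (cases "sweep cs ?N = ?N")
    case False
    then obtain x where "sweep cs ?N x \<noteq> ?N x" by blast
    then have x: "?N x" "\<not> sweep cs ?N x" "x \<in> insert 0 (set (code_stream cs))"
      using fold_update_le[of "positions cs" ?N] fold_update_support[of "positions cs" cs x ?N]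
      by (auto simp: sweep_def le_fun_def)
    have "A r \<subset> A (Suc r)"
      using x fold_update_le[of "positions cs" ?N] by (auto simp: A_def sweep_def le_fun_def)
    then have "card (A r) < card (A (Suc r))"
      by (rule psubset_card_mono[rotated]) (simp add: A_def)
    then show ?thesis using Suc False by simp
  qed simp
qed simp

text \<open>Every round short of a fixed point enlarges the set of derived objects, and there are
  only \<open>R\<close> of them. After \<open>R\<close> such rounds all are derived and nothing is
  left to change.\<close>

lemma sweep_fixed:
  fixes cs N
  defines "R \<equiv> Suc (card (set (code_stream cs) - {0}))"
  shows "sweep cs ((sweep cs ^^ R) N) = (sweep cs ^^ R) N"
proof (rule ccontr)
  let ?U = "insert 0 (set (code_stream cs))" and ?N = "(sweep cs ^^ R) N"
  assume neq: "sweep cs ?N \<noteq> ?N"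
  then have "R \<le> card {x \<in> ?U. \<not> ?N x}" using sweep_fixed_or_progress by blast
  \<comment> \<open>The object 0 is counted exactly once, even if the stream is empty.\<close>
  moreover have "card ?U = R" unfolding R_def by (simp add: card.insert_remove)
  ultimately have "{x \<in> ?U. \<not> ?N x} = ?U" by (intro card_seteq) auto
  then have "sweep cs ?N x = ?N x" for x
    using fold_update_support[of "positions cs" cs x ?N] fold_update_le[of "positions cs" ?N]
    by (cases "x \<in> ?U") (auto simp: sweep_def le_fun_def)
  then show False using neq by blast
qed

section \<open>Literals and clause-sets under partial assignments\<close>

lemma lit_val_compl [simp]: "lit_val \<phi> (compl l) = map_option Not (lit_val \<phi> l)"
  by (cases l) (simp_all add: option.map_comp comp_def option.map_ident)

lemma enc_lit_compl [simp]: "enc_lit (compl l) = - enc_lit l"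
  by (cases l) simp_all

lemma enc_lit_eq_iff [simp]: "enc_lit l = enc_lit l' \<longleftrightarrow> l = l'"
  by (cases l; cases l') auto

lemma enc_lit_neq_0 [simp]: "enc_lit l \<noteq> 0"
  by (cases l) auto

lemma lit_val_map_add:
  "lit_val (\<psi> ++ \<phi>) l = (case lit_val \<phi> l of None \<Rightarrow> lit_val \<psi> l | Some b \<Rightarrow> Some b)"
  by (cases l) (auto simp: map_add_def split: option.splits)

lemma apply_pa_eq:
  "apply_pa \<phi> F =
     (\<lambda>C. {x \<in> C. lit_val \<phi> x \<noteq> Some False}) ` {C \<in> F. \<forall>x\<in>C. lit_val \<phi> x \<noteq> Some True}"
  by (auto simp: apply_pa_def)

text \<open>The assignment applied first takes precedence, since its variables are gone when the
  second one is applied; \<open>++\<close> prefers its right operand.\<close>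

lemma apply_pa_apply_pa:
  fixes F :: "'a clauses"
  shows "apply_pa \<psi> (apply_pa \<phi> F) = apply_pa (\<psi> ++ \<phi>) F"
proof -
  let ?r = "\<lambda>C. {x \<in> C. lit_val \<phi> x \<noteq> Some False}"
  have eq: "{x \<in> ?r C. lit_val \<psi> x \<noteq> Some False} = {x \<in> C. lit_val (\<psi> ++ \<phi>) x \<noteq> Some False}"
    if "\<forall>x\<in>C. lit_val (\<psi> ++ \<phi>) x \<noteq> Some True" for C
    using that by (auto simp: lit_val_map_add split: option.splits)
  have true: "(\<forall>x\<in>C. lit_val (\<psi> ++ \<phi>) x \<noteq> Some True) \<longleftrightarrow>
      (\<forall>x\<in>C. lit_val \<phi> x \<noteq> Some True) \<and> (\<forall>x\<in>?r C. lit_val \<psi> x \<noteq> Some True)" for C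
  proof -
    have "lit_val (\<psi> ++ \<phi>) x \<noteq> Some True \<longleftrightarrow> lit_val \<phi> x \<noteq> Some True \<and>
        (lit_val \<phi> x \<noteq> Some False \<longrightarrow> lit_val \<psi> x \<noteq> Some True)" for x
      by (cases "lit_val \<phi> x") (auto simp: lit_val_map_add)
    then show ?thesis by blast
  qed
  have img: "h ` {D \<in> g ` A. Q D} = (\<lambda>C. h (g C)) ` {C \<in> A. Q (g C)}"
    for h g :: "'a clause \<Rightarrow> 'a clause" and A Q
    by auto
  have "apply_pa \<psi> (apply_pa \<phi> F) = (\<lambda>C. {x \<in> ?r C. lit_val \<psi> x \<noteq> Some False}) `
      {C \<in> F. \<forall>x\<in>C. lit_val (\<psi> ++ \<phi>) x \<noteq> Some True}"
    unfolding apply_pa_eq[of \<psi>] apply_pa_eq[of \<phi>] img true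
    by (simp only: mem_Collect_eq conj_assoc)
  also have "\<dots> = apply_pa (\<psi> ++ \<phi>) F"
    unfolding apply_pa_eq[of "\<psi> ++ \<phi>"] by (rule image_cong[OF refl]) (use eq in blast)
  finally show ?thesis .
qed

lemma lit_val_set_true:
  "lit_val (set_true x) l = (if l = x then Some True else if l = compl x then Some False else None)"
  by (cases x; cases l) auto

lemma vars_apply_set_true: "vars (apply_pa (set_true x) G) \<subseteq> vars G - {lit_var x}"
proof -
  have "lit_var l \<noteq> lit_var x" if "lit_val (set_true x) l \<noteq> Some False" "lit_val (set_true x) l \<noteq> Some True" for l
    using that by (cases x; cases l) auto
  then show ?thesis by (auto simp: vars_def apply_pa_def)
qed

text \<open>Induction on the number of remaining variables; this also covers the termination of \<open>r1\<close>,
  whose value would be unspecified otherwise.\<close>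

lemma r1_bot_imp_closed:
  fixes F :: "'v clauses"
  assumes F: "finite F" "\<forall>C\<in>F. finite C"
    and unit: "\<And>C l. C \<in> F \<Longrightarrow> l \<in> C \<Longrightarrow> (\<forall>l'\<in>C - {l}. P (compl l')) \<Longrightarrow> P l"
    and bot: "\<And>C. C \<in> F \<Longrightarrow> (\<forall>l\<in>C. P (compl l)) \<Longrightarrow> B"
    and \<phi>: "\<And>l. lit_val \<phi> l = Some True \<Longrightarrow> P l"
    and r1: "r1 (apply_pa \<phi> F) = {{}}"
  shows B
  using \<phi> r1
proof (induction "card (vars (apply_pa \<phi> F))" arbitrary: \<phi> rule: less_induct)
  case less
  let ?G = "apply_pa \<phi> F"
  have false: "P (compl l)" if "lit_val \<phi> l = Some False" for l
    using less.prems(1)[of "compl l"] that by simp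
  have fin: "finite ?G" "\<forall>C\<in>?G. finite C"
    using F by (auto simp: apply_pa_def)
  consider (bot) "{} \<in> ?G" | (stop) "{} \<notin> ?G" "\<forall>C\<in>?G. card C \<ge> 2"
    | (unit) "{} \<notin> ?G" "\<not> (\<forall>C\<in>?G. card C \<ge> 2)" by blast
  then show B
  proof cases
    case bot
    then obtain C where "C \<in> F" "\<forall>l\<in>C. lit_val \<phi> l = Some False" by (auto simp: apply_pa_def)
    then show B using assms(4) false by blast
  next
    case stop
    then have "r1 ?G = ?G" using r1.simps[of ?G] by presburger
    then show B using less.prems(2) stop(1) by (metis insertI1)
  next
    case unit
    define x where "x = (SOME x. {x} \<in> ?G)"
    obtain C where "C \<in> ?G" "card C < 2" using unit by (auto simp: not_le)
    moreover from this have "card C \<noteq> 0" using fin unit by (metis card_0_eq)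
    ultimately have "card C = 1" by simp
    then have "\<exists>x. {x} \<in> ?G" using \<open>C \<in> ?G\<close> by (metis card_1_singletonE)
    then have x: "{x} \<in> ?G" unfolding x_def by (rule someI_ex)
    then obtain C where C: "C \<in> F" "\<forall>l\<in>C. lit_val \<phi> l \<noteq> Some True"
        "{x} = {l \<in> C. lit_val \<phi> l \<noteq> Some False}"
      by (auto simp: apply_pa_def)
    \<comment> \<open>All literals of \<open>C\<close> other than \<open>x\<close> are falsified by
      \<open>\<phi>\<close>, so their complements satisfy \<open>P\<close> and the closure rule
      applies.\<close>
    then have "P x" using assms(3)[of C x] false by blast
    have "r1 ?G = r1 (apply_pa (set_true x) ?G)"
      using r1.simps[of ?G] unfolding if_not_P[OF unit(1)] if_not_P[OF unit(2)] x_def .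
    \<comment> \<open>The step is absorbed into the assignment while \<open>F\<close> stays fixed,
      so the closure assumptions about clauses of \<open>F\<close> remain applicable.\<close>
    then have "r1 (apply_pa (set_true x ++ \<phi>) F) = {{}}"
      using less.prems(2) by (simp add: apply_pa_apply_pa)
    moreover have "P l" if "lit_val (set_true x ++ \<phi>) l = Some True" for l
      using that less.prems(1)[of l] \<open>P x\<close>
      by (auto simp: lit_val_map_add lit_val_set_true split: option.splits if_splits)
    moreover have "card (vars (apply_pa (set_true x ++ \<phi>) F)) < card (vars ?G)"
    proof (rule psubset_card_mono)
      show "finite (vars ?G)" using fin by (simp add: vars_def)
      have "lit_var x \<in> vars ?G" using x by (force simp: vars_def)
      then show "vars (apply_pa (set_true x ++ \<phi>) F) \<subset> vars ?G"
        using vars_apply_set_true[of x ?G] by (auto simp: apply_pa_apply_pa)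
    qed
    ultimately show B using less.hyps by blast
  qed
qed

text \<open>The invariant is that derived literals are true in the model \<open>\<sigma>\<close>.
  The clause has a true literal, whose complement is never derived, so the others are alive unless
  the position being updated itself holds a true literal.\<close>

lemma update_sound:
  assumes d: "\<exists>l\<in>set d. lit_val \<sigma> l = Some True" and i: "i \<le> length d"
    and N: "N 0" "\<And>l. \<not> N (enc_lit l) \<Longrightarrow> lit_val \<sigma> l = Some True"
  shows "update (map enc_lit d, i) N 0"
    and "\<not> update (map enc_lit d, i) N (enc_lit l) \<Longrightarrow> lit_val \<sigma> l = Some True"
proof -
  have alive: "others_alive (map enc_lit d) i (length d) N"
    if "\<not> (i < length d \<and> lit_val \<sigma> (d ! i) = Some True)"
  proof -
    obtain j where j: "j < length d" "lit_val \<sigma> (d ! j) = Some True"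
      using d by (auto simp: in_set_conv_nth)
    have "N (- enc_lit (d ! j))"
      using N(2)[of "compl (d ! j)"] j by auto
    then show ?thesis using that j by (auto simp: others_alive_def)
  qed
  have target: "(map enc_lit d @ [0]) ! i = (if i < length d then enc_lit (d ! i) else 0)"
    using i by (simp add: nth_append)
  show "update (map enc_lit d, i) N 0"
    using N alive by (auto simp: target)
  show "lit_val \<sigma> l = Some True" if "\<not> update (map enc_lit d, i) N (enc_lit l)"
    using N alive that by (auto simp: target split: if_splits)
qed

lemma fold_update_sound:
  assumes "\<forall>d\<in>set L. \<exists>l\<in>set d. lit_val \<sigma> l = Some True"
    and "set ps \<subseteq> set (positions (map (map enc_lit) L))"
    and "N 0" "\<And>l. \<not> N (enc_lit l) \<Longrightarrow> lit_val \<sigma> l = Some True"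
  shows "fold update ps N 0 \<and> (\<forall>l. \<not> fold update ps N (enc_lit l) \<longrightarrow> lit_val \<sigma> l = Some True)"
  using assms(2-4)
proof (induction ps arbitrary: N)
  case (Cons p ps)
  obtain d i where p: "p = (map enc_lit d, i)" "d \<in> set L" "i \<le> length d"
    using Cons.prems(1) by (cases p) (auto simp: in_positions)
  have sound: "update p N 0" "\<not> update p N (enc_lit l) \<Longrightarrow> lit_val \<sigma> l = Some True" for l
    unfolding p(1)
    using update_sound(1)[where d = d and \<sigma> = \<sigma> and i = i and N = N]
      update_sound(2)[where d = d and \<sigma> = \<sigma> and i = i and N = N and l = l]
      assms(1) p(2,3) Cons.prems(2,3) by blast+
  have "fold update ps (update p N) 0 \<and>
      (\<forall>l. \<not> fold update ps (update p N) (enc_lit l) \<longrightarrow> lit_val \<sigma> l = Some True)"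
    by (rule Cons.IH) (use Cons.prems(1) sound in \<open>auto simp del: update.simps\<close>)
  then show ?case by (simp del: update.simps)
qed simp

lemma sweeps_sound:
  assumes "\<forall>d\<in>set L. \<exists>l\<in>set d. lit_val \<sigma> l = Some True"
    and "N 0" "\<And>l. \<not> N (enc_lit l) \<Longrightarrow> lit_val \<sigma> l = Some True"
  shows "(sweep (map (map enc_lit) L) ^^ r) N 0 \<and>
    (\<forall>l. \<not> (sweep (map (map enc_lit) L) ^^ r) N (enc_lit l) \<longrightarrow> lit_val \<sigma> l = Some True)"
proof (induction r)
  case (Suc r)
  then show ?case
    using fold_update_sound[OF assms(1) order.refl, of "(sweep (map (map enc_lit) L) ^^ r) N"]
    by (auto simp: sweep_def)
qed (use assms in auto)

lemma sweeps_le: "(sweep cs ^^ r) N \<le> N"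
proof (induction r)
  case (Suc r)
  then show ?case
    using fold_update_le[of "positions cs" "(sweep cs ^^ r) N"] unfolding sweep_def
    by simp
qed simp

text \<open>At a fixed point the derived literals are closed under unit resolution with the clauses
  of \<open>F\<close>, and the update of a terminator is the rule for the empty clause. Hence every
  refutation by \<open>r1\<close> is reproduced.\<close>

lemma propagation_complete:
  assumes L: "lists_clause_set L F" and F: "is_clause_set F"
    and fixed: "sweep (map (map enc_lit) L) N = N"
    and \<phi>: "\<And>l. lit_val \<phi> l = Some True \<Longrightarrow> \<not> N (enc_lit l)"
    and r1: "r1 (apply_pa \<phi> F) = {{}}"
  shows "\<not> N 0"
proof (rule r1_bot_imp_closed[where P = "\<lambda>l. \<not> N (enc_lit l)", OF _ _ _ _ \<phi> r1])
  have FL: "F = set ` set L" "\<forall>d\<in>set L. distinct d"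
    using L by (auto simp: lists_clause_set_def)
  have rule: "\<not> N ((map enc_lit d @ [0]) ! i)"
    if "d \<in> set L" "i \<le> length d" "\<And>j. j < length d \<Longrightarrow> j \<noteq> i \<Longrightarrow> \<not> N (enc_lit (compl (d ! j)))" for d i
  proof -
    have "update (map enc_lit d, i) N = N"
      by (rule fold_update_fixed[OF fixed[unfolded sweep_def]]) (use that in \<open>auto simp: in_positions\<close>)
    moreover have "\<not> update (map enc_lit d, i) N ((map enc_lit d @ [0]) ! i)"
      using that(3) by (auto simp: others_alive_def)
    ultimately show ?thesis by metis
  qed
  show "finite F" "\<forall>C\<in>F. finite C"
    using F by (auto simp: is_clause_set_def is_clause_def)
  show "\<not> N (enc_lit l)" if C: "C \<in> F" "l \<in> C" "\<forall>l'\<in>C - {l}. \<not> N (enc_lit (compl l'))" for C l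
  proof -
    obtain d where d: "d \<in> set L" "C = set d" "distinct d" using C FL by auto
    then obtain i where i: "i < length d" "d ! i = l" using C by (auto simp: in_set_conv_nth)
    \<comment> \<open>As the clause is listed without repetition, other positions hold other
      literals.\<close>
    have "\<not> N (enc_lit (compl (d ! j)))" if "j < length d" "j \<noteq> i" for j
      using that C(3) d i by (auto simp: nth_eq_iff_index_eq simp del: enc_lit_compl)
    then show ?thesis using rule[of d i] d i by (simp add: nth_append)
  qed
  show "\<not> N 0" if C: "C \<in> F" "\<forall>l\<in>C. \<not> N (enc_lit (compl l))" for C
  proof -
    obtain d where d: "d \<in> set L" "C = set d" using C FL by auto
    then show ?thesis using rule[of d "length d"] C by (simp add: nth_append)
  qed
qed

lemma propagation_sound:
  assumes L: "lists_clause_set L F" and sat: "satisfiable (apply_pa \<phi> F)"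
    and N: "N 0" "\<And>l. \<not> N (enc_lit l) \<Longrightarrow> lit_val \<phi> l = Some True"
  shows "(sweep (map (map enc_lit) L) ^^ r) N 0"
proof -
  \<comment> \<open>\<open>\<tau> ++ \<phi>\<close> is a model of \<open>F\<close> that agrees with
    \<open>\<phi>\<close>, so the literals derived at the outset are true in it.\<close>
  obtain \<tau> where "apply_pa (\<tau> ++ \<phi>) F = {}"
    using sat by (auto simp: satisfiable_def apply_pa_apply_pa)
  then have "\<forall>C\<in>F. \<exists>l\<in>C. lit_val (\<tau> ++ \<phi>) l = Some True"
    by (fastforce simp: apply_pa_def)
  then have "\<forall>d\<in>set L. \<exists>l\<in>set d. lit_val (\<tau> ++ \<phi>) l = Some True"
    using L by (auto simp: lists_clause_set_def)
  then show ?thesis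
    using sweeps_sound[where N = N and \<sigma> = "\<tau> ++ \<phi>"] N by (simp add: lit_val_map_add)
qed

text \<open>If both inputs of a variable are 0 the value is an arbitrary choice; the links to
  \<open>initial\<close> and to the monotonisation are stated for vectors where this does not
  happen.\<close>

definition partial_of :: "nat list \<Rightarrow> bool list \<Rightarrow> nat passign" where
  "partial_of vs ys v =
     (if \<exists>i<length vs. vs ! i = v \<and> \<not> ys ! (2 * i) then Some True
      else if \<exists>i<length vs. vs ! i = v \<and> \<not> ys ! (2 * i + 1) then Some False else None)"

lemma partial_of_nth:
  assumes "distinct vs" "i < length vs"
  shows "partial_of vs ys (vs ! i) =
    (if \<not> ys ! (2 * i) then Some True else if \<not> ys ! (2 * i + 1) then Some False else None)"
proof -
  have "(\<exists>j<length vs. vs ! j = vs ! i \<and> Q j) \<longleftrightarrow> Q i" for Q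
    using assms by (auto simp: nth_eq_iff_index_eq)
  then show ?thesis by (simp add: partial_of_def)
qed

lemma dom_partial_of: "dom (partial_of vs ys) \<subseteq> set vs"
  by (auto simp: partial_of_def split: if_splits)

lemma initial_partial_of:
  assumes "distinct vs" "\<forall>i<length vs. ys ! (2 * i) \<or> ys ! (2 * i + 1)"
  shows "initial vs (length vs) ys (enc_lit l) \<longleftrightarrow> lit_val (partial_of vs ys) l \<noteq> Some True"
proof (cases "lit_var l \<in> set vs")
  case True
  then obtain i where i: "i < length vs" "lit_var l = vs ! i" by (auto simp: in_set_conv_nth)
  then have "initial vs (length vs) ys (int (vs ! i) + 1) \<longleftrightarrow> ys ! (2 * i)"
      "initial vs (length vs) ys (- int (vs ! i) - 1) \<longleftrightarrow> ys ! (2 * i + 1)"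
    using assms(1) by (auto simp: initial_def nth_eq_iff_index_eq)
  then show ?thesis
    using i assms by (cases l) (auto simp: partial_of_nth)
next
  case False
  then have "partial_of vs ys (lit_var l) = None" using dom_partial_of by fast
  with False show ?thesis by (cases l) (auto simp: initial_def)
qed

text \<open>An input 0 forbids one value of its variable and so forces the other. Thus the witnesses
  of the monotonisation are the total extensions of \<open>partial_of\<close>, which is the form in
  which the hypothesis on \<open>F\<close> speaks of \<open>f\<close>.\<close>

lemma monotonisation_partial_of:
  assumes dist: "distinct vs" and ys: "\<forall>i<length vs. ys ! (2 * i) \<or> ys ! (2 * i + 1)"
  shows "monotonisation (length vs) f ys \<longleftrightarrow>
    (\<exists>\<psi>. dom \<psi> = set vs \<and> partial_of vs ys \<subseteq>\<^sub>m \<psi> \<and> f (map (\<lambda>v. the (\<psi> v)) vs))"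
proof
  assume "monotonisation (length vs) f ys"
  then obtain xs where xs: "length xs = length vs" "f xs"
    and le: "\<forall>i<length vs. (\<not> xs ! i \<longrightarrow> ys ! (2 * i)) \<and> (xs ! i \<longrightarrow> ys ! (2 * i + 1))"
    by (auto simp: monotonisation_def)
  let ?\<psi> = "map_of (zip vs xs)"
  have \<psi>: "?\<psi> (vs ! i) = Some (xs ! i)" if "i < length vs" for i
    using that dist xs by (simp add: map_of_zip_nth)
  have "partial_of vs ys \<subseteq>\<^sub>m ?\<psi>"
  proof (unfold map_le_def, intro ballI)
    fix v
    assume v: "v \<in> dom (partial_of vs ys)"
    then obtain i where i: "i < length vs" "v = vs ! i"
      using dom_partial_of by (metis in_set_conv_nth subsetD)
    then show "partial_of vs ys v = ?\<psi> v"
      using v le dist \<psi> by (auto simp: partial_of_nth dom_def split: if_splits)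
  qed
  moreover have "map (\<lambda>v. the (?\<psi> v)) vs = xs"
    using \<psi> xs by (intro nth_equalityI) auto
  ultimately show "\<exists>\<psi>. dom \<psi> = set vs \<and> partial_of vs ys \<subseteq>\<^sub>m \<psi> \<and> f (map (\<lambda>v. the (\<psi> v)) vs)"
    using xs by (intro exI[of _ ?\<psi>]) simp
next
  assume "\<exists>\<psi>. dom \<psi> = set vs \<and> partial_of vs ys \<subseteq>\<^sub>m \<psi> \<and> f (map (\<lambda>v. the (\<psi> v)) vs)"
  then obtain \<psi> where \<psi>: "partial_of vs ys \<subseteq>\<^sub>m \<psi>" "f (map (\<lambda>v. the (\<psi> v)) vs)" by blast
  have ext: "\<psi> (vs ! i) = Some b" if "partial_of vs ys (vs ! i) = Some b" for i b
    using \<psi>(1) that by (metis domI map_le_def)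
  have "(\<not> the (\<psi> (vs ! i)) \<longrightarrow> ys ! (2 * i)) \<and> (the (\<psi> (vs ! i)) \<longrightarrow> ys ! (2 * i + 1))"
    if "i < length vs" for i
    using partial_of_nth[OF dist that, of ys] ext[of i] ys that by (auto split: if_splits)
  then show "monotonisation (length vs) f ys"
    unfolding monotonisation_def using \<psi>(2)
    by (intro exI[of _ "map (\<lambda>v. the (\<psi> v)) vs"]) simp
qed

section \<open>Construction of the circuit and its cost\<close>

text \<open>Settles the two input vectors that are not mixed.\<close>

lemma const_free_gate_vals:
  assumes "\<forall>k<length Q. wf_gate m k (Q ! k)" "\<And>b. ConstG b \<notin> set Q"
  shows "set (gate_vals (replicate m v) Q) \<subseteq> {v}"
  using assms
proof (induction Q rule: rev_induct)
  case (snoc g Q)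
  have "wf_gate m k (Q ! k)" if "k < length Q" for k
    using snoc.prems(1)[rule_format, of k] that by (simp add: nth_append)
  then have IH: "set (gate_vals (replicate m v) Q) \<subseteq> {v}"
    using snoc.prems(2) by (intro snoc.IH) auto
  then have "gate_vals (replicate m v) Q ! i = v" if "i < length Q" for i
    using that by (metis length_gate_vals nth_mem singletonD subsetD)
  moreover have "wf_gate m (length Q) g" "\<And>b. g \<noteq> ConstG b"
    using snoc.prems(1)[rule_format, of "length Q"] snoc.prems(2) by auto
  ultimately have "gate_val (replicate m v) (gate_vals (replicate m v) Q) g = v"
    by (cases g) auto
  then show ?case using IH by (simp add: gate_vals_snoc)
qed (simp add: gate_vals_def)

lemma not_mixed_imp_replicate:
  assumes "length ys = m" "\<not> mixed m ys"
  obtains v where "ys = replicate m v"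
  using assms unfolding mixed_def by (metis (full_types) replicate_eqI)

lemma sweeps_compute_monotonisation:
  assumes F: "is_clause_set F" and L: "lists_clause_set L F" and dist: "distinct vs"
    and f: "\<forall>\<phi> :: nat passign. dom \<phi> \<subseteq> set vs \<longrightarrow>
          (if \<exists>\<psi>. dom \<psi> = set vs \<and> \<phi> \<subseteq>\<^sub>m \<psi> \<and> f (map (\<lambda>v. the (\<psi> v)) vs)
           then satisfiable (apply_pa \<phi> F)
           else r1 (apply_pa \<phi> F) = {{}})"
  defines "cs \<equiv> map (map enc_lit) L"
  shows "(sweep cs ^^ Suc (card (set (code_stream cs) - {0}))) (initial vs (length vs) ys) 0 \<and>
    (\<forall>i<length vs. ys ! (2 * i) \<or> ys ! (2 * i + 1)) \<longleftrightarrow> monotonisation (length vs) f ys"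
proof (cases "\<forall>i<length vs. ys ! (2 * i) \<or> ys ! (2 * i + 1)")
  case False
  \<comment> \<open>A variable with both inputs 0 has no admissible value, so both sides are
    false.\<close>
  then show ?thesis by (auto simp: monotonisation_def)
next
  case True
  let ?\<phi> = "partial_of vs ys" and ?N = "initial vs (length vs) ys"
  define r where "r = Suc (card (set (code_stream cs) - {0}))"
  note init = initial_partial_of[OF dist True]
  have ext: "if monotonisation (length vs) f ys
      then satisfiable (apply_pa ?\<phi> F) else r1 (apply_pa ?\<phi> F) = {{}}"
    unfolding monotonisation_partial_of[OF dist True] using f dom_partial_of by blast
  have "(sweep cs ^^ r) ?N 0 \<longleftrightarrow> monotonisation (length vs) f ys"
  proof (cases "monotonisation (length vs) f ys")
    case True
    then have "satisfiable (apply_pa ?\<phi> F)" using ext by simp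
    moreover have "?N 0" by (simp add: initial_def)
    ultimately have "(sweep cs ^^ r) ?N 0"
      unfolding cs_def using L by (intro propagation_sound) (auto simp: init)
    then show ?thesis using True by simp
  next
    case False
    then have "r1 (apply_pa ?\<phi> F) = {{}}" using ext by simp
    \<comment> \<open>Literals made true by the assignment are derived at the outset, and sweeps
      never revoke a derivation.\<close>
    moreover have "\<not> (sweep cs ^^ r) ?N (enc_lit l)" if "lit_val ?\<phi> l = Some True" for l
      using that sweeps_le[where cs = cs and r = r and N = ?N] init[of l] by (auto simp: le_fun_def)
    moreover have "sweep cs ((sweep cs ^^ r) ?N) = (sweep cs ^^ r) ?N"
      unfolding r_def by (rule sweep_fixed)
    ultimately have "\<not> (sweep cs ^^ r) ?N 0"
      using propagation_complete[OF L F] unfolding cs_def by blast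
    then show ?thesis using False by simp
  qed
  then show ?thesis using True unfolding r_def by blast
qed

section \<open>Size of the input and total running time\<close>

lemma sum_list_ge_length:
  "distinct L \<Longrightarrow> length L \<le> sum_list (map length L) + (if [] \<in> set L then 1 else 0)"
proof (induction L)
  case (Cons d L)
  then show ?case by (cases d) (auto split: if_splits)
qed simp

text \<open>Without complementary pairs, \<open>lit_var\<close> is injective on a clause.\<close>

lemma clause_size_le:
  assumes "is_clause_set F" "C \<in> F"
  shows "card C \<le> num_vars F"
proof -
  have "inj_on lit_var C"
  proof (rule inj_onI)
    fix x y assume "x \<in> C" "y \<in> C" "lit_var x = lit_var y"
    then show "x = y"
      using assms by (cases x; cases y) (force simp: is_clause_set_def is_clause_def)+
  qed
  then have "card C = card (lit_var ` C)" by (simp add: card_image)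
  also have "\<dots> \<le> num_vars F"
    unfolding num_vars_def using assms
    by (intro card_mono) (auto simp: vars_def is_clause_set_def is_clause_def)
  finally show ?thesis .
qed

lemma num_vars_le_num_lits:
  assumes "is_clause_set F"
  shows "num_vars F \<le> num_lits F"
proof -
  have "num_vars F \<le> (\<Sum>C\<in>F. card (lit_var ` C))"
    unfolding num_vars_def vars_def using assms by (intro card_UN_le) (simp add: is_clause_set_def)
  also have "\<dots> \<le> num_lits F"
    unfolding num_lits_def using assms
    by (intro sum_mono card_image_le) (simp add: is_clause_set_def is_clause_def)
  finally show ?thesis .
qed

text \<open>At most one listed clause is empty and every other one contains a literal, so the
  terminators at most double the stream, up to one extra cell. The last bound counts two literals
  per variable.\<close>

lemma listing_sizes:
  assumes F: "is_clause_set F" and L: "lists_clause_set L F"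
  defines "cs \<equiv> map (map enc_lit) L"
  shows "\<forall>c\<in>set cs. 0 \<notin> set c \<and> length c \<le> num_vars F"
    and "length (code_stream cs) \<le> 2 * num_lits F + 1"
    and "card (set (code_stream cs) - {0}) \<le> 2 * num_vars F"
proof -
  have FL: "F = set (map set L)" "distinct (map set L)" "\<forall>d\<in>set L. distinct d"
    using L by (auto simp: lists_clause_set_def)
  show "\<forall>c\<in>set cs. 0 \<notin> set c \<and> length c \<le> num_vars F"
    using clause_size_le[OF F] FL by (auto simp: cs_def image_iff distinct_card[symmetric])
  have "num_lits F = sum_list (map card (map set L))"
    unfolding num_lits_def FL(1) using FL(2) by (rule sum.distinct_set_conv_list)
  also have "map card (map set L) = map length L"
    using FL(3) by (simp add: distinct_card)
  finally have lits: "num_lits F = sum_list (map length L)" .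
  have "length (code_stream cs) = sum_list (map length L) + length L"
    unfolding cs_def code_stream_def by (induction L) simp_all
  moreover have "length L \<le> sum_list (map length L) + 1"
    using sum_list_ge_length[of L] FL(2) by (auto simp: distinct_map split: if_splits)
  ultimately show "length (code_stream cs) \<le> 2 * num_lits F + 1"
    using lits by simp
  have fin: "finite (vars F)"
    using F by (auto simp: vars_def is_clause_set_def is_clause_def)
  have "set (code_stream cs) - {0} \<subseteq> enc_lit ` (Pos ` vars F \<union> Neg ` vars F)"
  proof
    fix x assume "x \<in> set (code_stream cs) - {0}"
    then obtain d l where "d \<in> set L" "l \<in> set d" "x = enc_lit l"
      by (auto simp: code_stream_def cs_def split: if_splits)
    then show "x \<in> enc_lit ` (Pos ` vars F \<union> Neg ` vars F)"
      unfolding vars_def FL(1) by (cases l) force+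
  qed
  then have "card (set (code_stream cs) - {0}) \<le> card (enc_lit ` (Pos ` vars F \<union> Neg ` vars F))"
    using fin by (intro card_mono) auto
  also have "\<dots> \<le> card (Pos ` vars F \<union> Neg ` vars F)"
    using fin by (intro card_image_le) auto
  also have "\<dots> \<le> card (Pos ` vars F) + card (Neg ` vars F)"
    by (rule card_Un_le)
  also have "\<dots> \<le> num_vars F + num_vars F"
    unfolding num_vars_def using fin by (intro add_mono card_image_le)
  finally show "card (set (code_stream cs) - {0}) \<le> 2 * num_vars F" by simp
qed

text \<open>For \<open>v > 0\<close> the leading term is rounds times stream positions times cost
  per position, at most \<open>3 * v\<close>, \<open>3 * l\<close> and \<open>310 * v\<close>; this
  is the 2790. For \<open>v = 0\<close> the cost is constant and the summand 1 absorbs it.\<close>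

lemma time_bound:
  fixes n v l M R :: nat
  assumes "n \<le> v" "v \<le> l" "v = 0 \<longrightarrow> l = 0" "M \<le> 2 * l + 1" "R \<le> 2 * v + 1"
  shows "n * 1004 + M * 104 + R * (M * (v * 106 + 204) + 24) + 200 \<le> 5000 * (l * v ^ 2 + 1)"
proof (cases "v = 0")
  case True
  then have "n = 0" "M \<le> 1" "R \<le> 1" using assms by auto
  then have "R * (M * 204 + 24) \<le> 1 * (1 * 204 + 24)"
    by (intro mult_le_mono add_mono) auto
  then show ?thesis using True \<open>n = 0\<close> \<open>M \<le> 1\<close> by simp
next
  case False
  then have v: "1 \<le> v" "1 \<le> l" using assms by auto
  define X where "X = l * v ^ 2"
  have X: "l \<le> X" "v \<le> X"
    using v unfolding X_def power2_eq_square by (simp_all add: mult.commute)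
  have M: "M \<le> 3 * l" and R: "R \<le> 3 * v" using assms v by auto
  have "R * (M * (v * 106 + 204) + 24) \<le> (3 * v) * ((3 * l) * (v * 106 + 204 * v) + 24)"
    using M R v by (intro mult_le_mono add_mono) auto
  also have "\<dots> = 2790 * X + 72 * v" by (simp add: X_def algebra_simps power2_eq_square)
  finally have Y: "R * (M * (v * 106 + 204) + 24) \<le> 2790 * X + 72 * v" .
  define Y where "Y = R * (M * (v * 106 + 204) + 24)"
  \<comment> \<open>The coefficients of \<open>X\<close> add up to 1004 + 312 + 2790 + 72 =
    4178.\<close>
  have "1004 * n + 104 * M + Y + 200 \<le> 5000 * X + 5000"
    using assms(1) M X Y unfolding Y_def[symmetric] by linarith
  then show ?thesis
    unfolding X_def[symmetric] Y_def[symmetric] by (simp add: mult.commute)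
qed

theorem theorem6p1:
  "\<exists>(p :: com) (c :: nat).
     \<forall>(vs :: nat list) (f :: bool list \<Rightarrow> bool) (F :: nat clauses) (L :: nat literal list list).
       is_clause_set F \<and> lists_clause_set L F \<and>
       distinct vs \<and> set vs \<subseteq> vars F \<and>
       (\<forall>\<phi> :: nat passign. dom \<phi> \<subseteq> set vs \<longrightarrow>
          (if \<exists>\<psi>. dom \<psi> = set vs \<and> \<phi> \<subseteq>\<^sub>m \<psi> \<and> f (map (\<lambda>v. the (\<psi> v)) vs)
           then satisfiable (apply_pa \<phi> F)
           else r1 (apply_pa \<phi> F) = {{}}))
       \<longrightarrow>
       (\<exists>t s Q.
          exec p (init_state (enc_input vs L)) t s \<and>
          t \<le> c * (num_lits F * num_vars F ^ 2 + 1) \<and>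
          has_output s (enc_circuit Q) \<and>
          circuit_computes Q (2 * length vs) (monotonisation (length vs) f) \<and>
          ((\<exists>b. ConstG b \<in> set Q) \<longrightarrow>
             is_constant (2 * length vs) (monotonisation (length vs) f)))"
proof (rule exI[of _ circuit_program], rule exI[of _ 5000], intro allI impI)
  fix vs :: "nat list" and f F and L :: "nat literal list list"
  assume hyps: "is_clause_set F \<and> lists_clause_set L F \<and>
       distinct vs \<and> set vs \<subseteq> vars F \<and>
       (\<forall>\<phi> :: nat passign. dom \<phi> \<subseteq> set vs \<longrightarrow>
          (if \<exists>\<psi>. dom \<psi> = set vs \<and> \<phi> \<subseteq>\<^sub>m \<psi> \<and> f (map (\<lambda>v. the (\<psi> v)) vs)
           then satisfiable (apply_pa \<phi> F)
           else r1 (apply_pa \<phi> F) = {{}}))"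
  then have F: "is_clause_set F" and L: "lists_clause_set L F" and dist: "distinct vs"
    and vs: "set vs \<subseteq> vars F" by blast+
  let ?cs = "map (map enc_lit) L" and ?m = "2 * length vs" and ?g = "monotonisation (length vs) f"
  let ?ones = "replicate ?m True"
  define N where "N ys = (sweep ?cs ^^ Suc (card (set (code_stream ?cs) - {0})))
    (initial vs (length vs) ys)" for ys
  have N: "N ys 0 \<and> (\<forall>i<length vs. ys ! (2 * i) \<or> ys ! (2 * i + 1)) \<longleftrightarrow> ?g ys" for ys
    unfolding N_def using sweeps_compute_monotonisation[OF F L dist] hyps by blast
  have ones: "N ?ones 0 \<longleftrightarrow> ?g ?ones" using N[of ?ones] by auto
  \<comment> \<open>By this monotonicity, the value false at the vector of ones means false
    everywhere.\<close>
  have le_ones: "?g ys \<Longrightarrow> ?g ?ones" for ys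
    by (auto simp: monotonisation_def)
  note sizes = listing_sizes[OF F L]
  have input: "enc_input vs L =
      [int (length vs)] @ map (\<lambda>v. int v + 1) vs @ [int (length ?cs)] @ code_stream ?cs"
    by (simp add: enc_input_def code_stream_def comp_def)
  from circuit_program_correct[OF dist sizes(1)] obtain t s Q where
    run: "exec circuit_program (init_state (enc_input vs L)) t s" and
    t: "t \<le> length vs * 1004 + length (code_stream ?cs) * 104 +
      Suc (card (set (code_stream ?cs) - {0})) *
      (length (code_stream ?cs) * (num_vars F * 106 + 204) + 24) + 200" and
    out: "has_output s (enc_circuit Q)" and
    Q: "if vs \<noteq> [] \<and> N ?ones 0
     then wf_circuit ?m Q \<and> (\<forall>b. ConstG b \<notin> set Q) \<and>
       (\<forall>ys. mixed ?m ys \<longrightarrow>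
          circuit_val Q ys = (N ys 0 \<and> (\<forall>i<length vs. ys ! (2 * i) \<or> ys ! (2 * i + 1))))
     else Q = [ConstG (N ?ones 0)]"
    unfolding input N_def by blast
  have time: "t \<le> 5000 * (num_lits F * num_vars F ^ 2 + 1)"
  proof -
    have "finite (vars F)" using F by (auto simp: vars_def is_clause_set_def is_clause_def)
    then have "length vs \<le> num_vars F"
      unfolding num_vars_def using vs dist by (metis card_mono distinct_card)
    moreover have "num_vars F = 0 \<longrightarrow> num_lits F = 0"
      unfolding num_lits_def using clause_size_le[OF F] by (metis le_0_eq sum.neutral)
    ultimately show ?thesis
      using sizes(2,3) num_vars_le_num_lits[OF F] by (intro order.trans[OF t] time_bound) auto
  qed
  have "circuit_computes Q ?m ?g \<and> ((\<exists>b. ConstG b \<in> set Q) \<longrightarrow> is_constant ?m ?g)"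
  proof (cases "vs \<noteq> [] \<and> N ?ones 0")
    case True
    then have wf: "wf_circuit ?m Q" and const: "\<And>b. ConstG b \<notin> set Q"
      and val: "\<And>ys. mixed ?m ys \<Longrightarrow> circuit_val Q ys = ?g ys"
      using Q N by simp_all
    have "circuit_val Q (replicate ?m v) = ?g (replicate ?m v)" for v
    proof -
      have "gate_vals (replicate ?m v) Q \<noteq> []"
        using wf by (metis length_greater_0_conv length_gate_vals wf_circuit_def)
      then have "circuit_val Q (replicate ?m v) \<in> set (gate_vals (replicate ?m v) Q)"
        unfolding circuit_val_def by (rule last_in_set)
      then have "circuit_val Q (replicate ?m v) = v"
        using const_free_gate_vals[of Q ?m v] wf const by (auto simp: wf_circuit_def)
      moreover have "?g (replicate ?m v) = v"
      proof (cases v)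
        case True
        then show ?thesis using \<open>vs \<noteq> [] \<and> N ?ones 0\<close> ones by simp
      next
        case False
        \<comment> \<open>With at least one variable, the zero vector contradicts itself at the
          first one, so the monotonisation is false there.\<close>
        have "0 < length vs" using \<open>vs \<noteq> [] \<and> N ?ones 0\<close> by simp
        then show ?thesis using False by (force simp: monotonisation_def)
      qed
      ultimately show ?thesis by simp
    qed
    then have "circuit_val Q ys = ?g ys" if "length ys = ?m" for ys
      using val that by (metis not_mixed_imp_replicate)
    then show ?thesis using wf const by (auto simp: circuit_computes_def)
  next
    case False
    then have Q': "Q = [ConstG (N ?ones 0)]" using Q by simp
    have "?g ys = N ?ones 0" if "length ys = ?m" for ys
    proof (cases "vs = []")
      case True
      \<comment> \<open>The only vector of length 0 coincides with the vector of ones.\<close>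
      then show ?thesis using that ones by simp
    next
      case False
      then show ?thesis using \<open>\<not> (vs \<noteq> [] \<and> N ?ones 0)\<close> ones le_ones by blast
    qed
    then show ?thesis
      by (auto simp: Q' circuit_computes_def is_constant_def wf_circuit_def circuit_val_def gate_vals_def)
  qed
  then show "\<exists>t s Q. exec circuit_program (init_state (enc_input vs L)) t s \<and>
      t \<le> 5000 * (num_lits F * num_vars F ^ 2 + 1) \<and> has_output s (enc_circuit Q) \<and>
      circuit_computes Q ?m ?g \<and> ((\<exists>b. ConstG b \<in> set Q) \<longrightarrow> is_constant ?m ?g)"
    using run time out by blast
qed

end
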